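(* Let $f\in S^*(\mathbb{R}^d)$ be a temperate distribution whose Fourier transform $\hat f$ is a pure point measure such that $|\hat f|(B(0,r))=O(r^T)$ as $r\to\infty$ with some $T<\infty$. Then $f$ is an s-almost periodic distribution.
   Context: $S(\mathbb{R}^d)$ is the Schwartz space and $S^*(\mathbb{R}^d)$ is the space of temperate (tempered) distributions. The Fourier transform of a test function is $\hat\varphi(y)=\int_{\mathbb{R}^d}\varphi(x)e^{-2\pi i\langle x,y\rangle}dx$, and for $f\in S^*(\mathbb{R}^d)$ it is defined by $\hat f(\varphi)=f(\hat\varphi)$. A measure means a complex-valued (locally finite, Radon) measure on $\mathbb{R}^d$; $|\mu|$ is the variation of $\mu$. A measure is pure point if it has the form $\sum_{\lambda\in\Lambda}a_\lambda\delta_\lambda$ with $a_\lambda\in\mathbb{C}$ and countable $\Lambda\subset\mathbb{R}^d$, where $\delta_\lambda$ is the unit mass at $\lambda$. $B(x,r)$ is the ball with center $x$ and radius $r$. A continuous function $g$ on $\mathbb{R}^d$ is almost periodic if for every $\varepsilon>0$ the set $\{\tau\in\mathbb{R}^d:\sup_{x}|g(x+\tau)-g(x)|<\varepsilon\}$ is relatively dense (i.e. for some $R<\infty$ it meets every ball of radius $R$). A distribution $f\in S^*(\mathbb{R}^d)$ is s-almost periodic if $t\mapsto(\psi\star f)(t)=f(\psi(t-\cdot))$ is almost periodic for every $\psi\in S(\mathbb{R}^d)$. *)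

theory Defs
  imports "HOL-Analysis.Analysis" "HOL-Library.Landau_Symbols" "HOL-Library.Disjoint_Sets"
begin

text \<open>The space \<open>\<real>\<^sup>d\<close> is an arbitrary type of class \<open>euclidean_space\<close>, with \<open>d = DIM('a)\<close>.
  Spaces of test functions are sets of functions, and a distribution is a functional on all
  functions of which only the values on the relevant set of test functions are constrained.\<close>

primrec iter_partial ::
  "'a::euclidean_space list \<Rightarrow> ('a \<Rightarrow> complex) \<Rightarrow> 'a \<Rightarrow> complex" where
  "iter_partial [] \<phi> = \<phi>"
| "iter_partial (b # bs) \<phi> = (\<lambda>x. frechet_derivative (iter_partial bs \<phi>) (at x) b)"

text \<open>Differentiability of every iterated partial derivative makes all of them continuous,
  so this is \<open>C\<^sup>\<infinity>\<close>.\<close>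

definition smooth :: "('a::euclidean_space \<Rightarrow> complex) \<Rightarrow> bool" where
  "smooth \<phi> \<longleftrightarrow>
     (\<forall>bs. set bs \<subseteq> Basis \<longrightarrow> (\<forall>x. iter_partial bs \<phi> differentiable (at x)))"

definition schwartz :: "('a::euclidean_space \<Rightarrow> complex) set" where
  "schwartz = {\<phi>. smooth \<phi> \<and>
     (\<forall>k bs. set bs \<subseteq> Basis \<longrightarrow>
        bdd_above (range (\<lambda>x. (1 + norm x) ^ k * norm (iter_partial bs \<phi> x))))}"

definition schwartz_seminorm ::
  "nat \<Rightarrow> 'a::euclidean_space list \<Rightarrow> ('a \<Rightarrow> complex) \<Rightarrow> real" where
  "schwartz_seminorm k bs \<phi> = (SUP x. (1 + norm x) ^ k * norm (iter_partial bs \<phi> x))"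

definition schwartz_topology :: "('a::euclidean_space \<Rightarrow> complex) topology" where
  "schwartz_topology = topology_generated_by
     {{\<psi> \<in> schwartz. schwartz_seminorm k bs (\<lambda>x. \<psi> x - \<phi> x) < \<epsilon>} | \<phi> k bs \<epsilon>.
        \<phi> \<in> schwartz \<and> set bs \<subseteq> Basis \<and> \<epsilon> > 0}"

definition tempered_distribution :: "(('a::euclidean_space \<Rightarrow> complex) \<Rightarrow> complex) \<Rightarrow> bool" where
  "tempered_distribution f \<longleftrightarrow>
     (\<forall>\<phi>\<in>schwartz. \<forall>\<psi>\<in>schwartz. f (\<lambda>x. \<phi> x + \<psi> x) = f \<phi> + f \<psi>) \<and>
     (\<forall>c. \<forall>\<phi>\<in>schwartz. f (\<lambda>x. c * \<phi> x) = c * f \<phi>) \<and>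
     continuous_map schwartz_topology euclidean f"

definition fourier :: "('a::euclidean_space \<Rightarrow> complex) \<Rightarrow> 'a \<Rightarrow> complex" where
  "fourier \<phi> y =
     (LINT x|lborel. \<phi> x * exp (- 2 * complex_of_real pi * \<i> * complex_of_real (x \<bullet> y)))"

definition fourier_dist ::
  "(('a::euclidean_space \<Rightarrow> complex) \<Rightarrow> complex) \<Rightarrow> ('a \<Rightarrow> complex) \<Rightarrow> complex" where
  "fourier_dist f \<phi> = f (fourier \<phi>)"

text \<open>A locally finite complex measure need not be defined on unbounded sets; it is represented
  by a set function of which only the values on bounded Borel sets are constrained.\<close>

definition bounded_borel :: "'a::euclidean_space set set" where
  "bounded_borel = {E \<in> sets borel. bounded E}"

text \<open>For bounded Borel \<open>E\<close>, using families with union contained in \<open>E\<close> instead of partitions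
  of \<open>E\<close> does not change the supremum, since the remainder of \<open>E\<close> can be added to the family.\<close>

definition variation :: "('a::euclidean_space set \<Rightarrow> complex) \<Rightarrow> 'a set \<Rightarrow> ennreal" where
  "variation \<mu> E =
     (SUP P \<in> {P. finite P \<and> disjoint P \<and> P \<subseteq> bounded_borel \<and> \<Union>P \<subseteq> E}.
        ennreal (\<Sum>F\<in>P. cmod (\<mu> F)))"

text \<open>Regularity is not a separate requirement: on a Euclidean space every locally finite Borel
  measure is regular.\<close>

definition complex_radon_measure :: "('a::euclidean_space set \<Rightarrow> complex) \<Rightarrow> bool" where
  "complex_radon_measure \<mu> \<longleftrightarrow>
     (\<forall>A :: nat \<Rightarrow> 'a set. range A \<subseteq> sets borel \<and> disjoint_family A \<and> bounded (\<Union>i. A i) \<longrightarrow>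
        (\<lambda>i. \<mu> (A i)) sums \<mu> (\<Union>i. A i)) \<and>
     (\<forall>E\<in>bounded_borel. variation \<mu> E < \<infinity>)"

text \<open>\<open>\<mu> = \<Sum>\<^sub>\<lambda> a\<^sub>\<lambda> \<delta>\<^sub>\<lambda>\<close>, where \<open>\<delta>\<^sub>\<lambda> E\<close> is \<open>indicator E \<lambda>\<close>.\<close>

definition pure_point :: "('a::euclidean_space set \<Rightarrow> complex) \<Rightarrow> bool" where
  "pure_point \<mu> \<longleftrightarrow>
     (\<exists>\<Lambda> a. countable \<Lambda> \<and>
        (\<forall>E\<in>bounded_borel. ((\<lambda>l. a l * indicator E l) has_sum \<mu> E) \<Lambda>))"

text \<open>The positive part in the Jordan decomposition of a real set function \<open>\<nu>\<close> on bounded Borel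
  sets, as a positive Borel measure. The argument of \<open>ennreal\<close> may be negative, which
  \<open>ennreal\<close> maps to 0; this is harmless as \<open>F = {}\<close> already contributes 0.\<close>

definition jordan_pos :: "('a::euclidean_space set \<Rightarrow> real) \<Rightarrow> 'a measure" where
  "jordan_pos \<nu> =
     measure_of UNIV (sets borel) (\<lambda>E. SUP F \<in> {F \<in> bounded_borel. F \<subseteq> E}. ennreal (\<nu> F))"

definition cmeasure_integral ::
  "('a::euclidean_space set \<Rightarrow> complex) \<Rightarrow> ('a \<Rightarrow> complex) \<Rightarrow> complex" where
  "cmeasure_integral \<mu> \<phi> =
     (LINT x|jordan_pos (\<lambda>E. Re (\<mu> E)). \<phi> x) - (LINT x|jordan_pos (\<lambda>E. - Re (\<mu> E)). \<phi> x) +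
     \<i> * ((LINT x|jordan_pos (\<lambda>E. Im (\<mu> E)). \<phi> x) - (LINT x|jordan_pos (\<lambda>E. - Im (\<mu> E)). \<phi> x))"

text \<open>A distribution is identified with a measure through compactly supported smooth functions:
  a Schwartz function need not be integrable with respect to a locally finite measure.\<close>

definition distribution_is_measure ::
  "(('a::euclidean_space \<Rightarrow> complex) \<Rightarrow> complex) \<Rightarrow> ('a set \<Rightarrow> complex) \<Rightarrow> bool" where
  "distribution_is_measure f \<mu> \<longleftrightarrow> complex_radon_measure \<mu> \<and>
     (\<forall>\<phi>. smooth \<phi> \<and> compact (closure {x. \<phi> x \<noteq> 0}) \<longrightarrow> f \<phi> = cmeasure_integral \<mu> \<phi>)"

definition relatively_dense :: "'a::euclidean_space set \<Rightarrow> bool" where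
  "relatively_dense A \<longleftrightarrow> (\<exists>R. \<forall>x. A \<inter> ball x R \<noteq> {})"

text \<open>The supremum is taken in \<open>ennreal\<close> because it may be infinite.\<close>

definition almost_periodic :: "('a::euclidean_space \<Rightarrow> complex) \<Rightarrow> bool" where
  "almost_periodic g \<longleftrightarrow> continuous_on UNIV g \<and>
     (\<forall>\<epsilon>>0. relatively_dense {\<tau>. (SUP x. ennreal (cmod (g (x + \<tau>) - g x))) < ennreal \<epsilon>})"

definition s_almost_periodic :: "(('a::euclidean_space \<Rightarrow> complex) \<Rightarrow> complex) \<Rightarrow> bool" where
  "s_almost_periodic f \<longleftrightarrow> (\<forall>\<psi>\<in>schwartz. almost_periodic (\<lambda>t. f (\<lambda>x. \<psi> (t - x))))"

end

theory Submission
  imports Defs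
begin

text \<open>Let \<open>h\<close> be a smooth cutoff with \<open>c = \<integral> fourier h \<noteq> 0\<close>. For a Schwartz function \<open>\<omega>\<close>, Fubini identifies
  the Fourier transform of the test function \<open>y \<mapsto> h (y/n) * fourier \<omega> (-y)\<close> with the convolution of
  \<open>\<omega>\<close> with the rescaled kernel \<open>fourier h\<close>, and these convolutions converge to \<open>c * \<omega>\<close> in the Schwartz
  topology. Applying \<open>f\<close> and letting \<open>n \<rightarrow> \<infinity>\<close> gives
  \<open>c * f \<omega> = h 0 * (\<Sum>\<^sub>l a\<^sub>l * fourier \<omega> (-l))\<close>, where the growth condition on the variation and the
  rapid decrease of \<open>fourier \<omega>\<close> make the series absolutely convergent. For \<open>\<omega> = \<psi> (t - \<cdot>)\<close> its terms are
  \<open>a\<^sub>l * fourier \<psi> l\<close> times the character \<open>exp (2 \<pi> i \<langle>t, l\<rangle>)\<close>, so \<open>t \<mapsto> f (\<psi> (t - \<cdot>))\<close> is a uniform limit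
  of trigonometric polynomials.\<close>

section \<open>Smooth functions\<close>

text \<open>The measure represents the transform of \<open>f\<close> only on smooth functions of
  compact support, while \<open>fourier \<omega>\<close> usually has unbounded support. This forces
  the cutoff, and the work lies in removing it on both sides. On the side of \<open>f\<close> the
  only continuity available is that of the Schwartz topology, so the convolutions must converge in
  every seminorm; hence the mean value and Taylor bounds carry powers of 1 + |x|. On the side of the
  measure the cutoff is removed by dominated convergence, since h (y/n) is bounded and tends to h 0.
  The argument -y occurs because reversing the sign turns the Fourier transform into its inverse:
  the uncut function would be carried back to \<omega>, and with the cutoff the result is a
  superposition of translates of \<omega> by vectors of size about 1/n, weighted by
  \<open>fourier h\<close>. A uniform limit of trigonometric polynomials inherits its almost periods
  from finitely many characters, and these have common ones by the pigeonhole principle on a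
  torus.\<close>

definition partial :: "'a::euclidean_space \<Rightarrow> ('a \<Rightarrow> complex) \<Rightarrow> 'a \<Rightarrow> complex" where
  "partial b \<phi> x = frechet_derivative \<phi> (at x) b"

lemma iter_partial_Cons: "iter_partial (b # bs) \<phi> = partial b (iter_partial bs \<phi>)"
  by (simp add: partial_def fun_eq_iff)

lemma iter_partial_append: "iter_partial (bs @ cs) \<phi> = iter_partial bs (iter_partial cs \<phi>)"
  by (induction bs) auto

lemma iter_partial_snoc: "iter_partial (bs @ [b]) \<phi> = iter_partial bs (partial b \<phi>)"
  by (simp only: iter_partial_append iter_partial_Cons iter_partial.simps(1))

declare iter_partial.simps(2) [simp del]
declare iter_partial_Cons [simp]

lemma partial_eqI: "(\<phi> has_derivative D) (at x) \<Longrightarrow> partial b \<phi> x = D b"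
  unfolding partial_def using frechet_derivative_at by metis

lemma smooth_iter_differentiable:
  "smooth \<phi> \<Longrightarrow> set bs \<subseteq> Basis \<Longrightarrow> iter_partial bs \<phi> differentiable (at x)"
  by (auto simp: smooth_def)

lemma smooth_differentiable: "smooth \<phi> \<Longrightarrow> \<phi> differentiable (at x)"
  using smooth_iter_differentiable[of \<phi> "[]"] by simp

lemma smooth_partial: "smooth \<phi> \<Longrightarrow> b \<in> Basis \<Longrightarrow> smooth (partial b \<phi>)"
  unfolding smooth_def
  by (metis iter_partial_snoc le_sup_iff list.set(1) list.simps(15) set_append empty_subsetI insert_subset)

lemma smooth_iter_partial: "smooth \<phi> \<Longrightarrow> set bs \<subseteq> Basis \<Longrightarrow> smooth (iter_partial bs \<phi>)"
  by (induction bs) (auto intro: smooth_partial)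

lemma smooth_continuous_on: "smooth \<phi> \<Longrightarrow> continuous_on S \<phi>"
  by (meson continuous_at_imp_continuous_on differentiable_imp_continuous_within smooth_differentiable)

text \<open>Linearity of the derivative and expansion in \<open>Basis\<close>. This leads from
  partial derivatives back to \<open>has_derivative\<close>, the form in which the chain rule and
  the mean value inequality apply.\<close>

lemma differentiable_has_derivative_partial:
  assumes "\<phi> differentiable (at x)"
  shows "(\<phi> has_derivative (\<lambda>z. \<Sum>b\<in>Basis. (z \<bullet> b) *\<^sub>R partial b \<phi> x)) (at x)"
proof -
  obtain D where D: "(\<phi> has_derivative D) (at x)"
    using assms by (auto simp: differentiable_def)
  have "linear D" using D has_derivative_linear by blast
  have "D z = (\<Sum>b\<in>Basis. (z \<bullet> b) *\<^sub>R partial b \<phi> x)" for z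
  proof -
    have "D z = D (\<Sum>b\<in>Basis. (z \<bullet> b) *\<^sub>R b)" by (simp add: euclidean_representation)
    also have "\<dots> = (\<Sum>b\<in>Basis. (z \<bullet> b) *\<^sub>R D b)"
      using \<open>linear D\<close> by (simp add: linear_sum linear_scale)
    finally show ?thesis by (simp add: partial_eqI[OF D])
  qed
  then have "D = (\<lambda>z. \<Sum>b\<in>Basis. (z \<bullet> b) *\<^sub>R partial b \<phi> x)" by (rule ext)
  then show ?thesis using D by (simp only:)
qed

lemmas smooth_has_derivative = differentiable_has_derivative_partial[OF smooth_differentiable]

text \<open>By induction on the list of directions, every iterated partial derivative stays in
  \<open>S\<close>. Smoothness thus follows from first derivatives alone, with no formula for the
  higher ones; for Fourier transforms and convolutions, \<open>S\<close> is a whole family of such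
  functions.\<close>

lemma smooth_coinduct:
  assumes "\<phi> \<in> S"
    and diff: "\<And>\<phi> x. \<phi> \<in> S \<Longrightarrow> \<phi> differentiable (at x)"
    and part: "\<And>\<phi> b. \<phi> \<in> S \<Longrightarrow> b \<in> Basis \<Longrightarrow> partial b \<phi> \<in> S"
  shows "smooth \<phi>"
proof -
  have "iter_partial bs \<phi> \<in> S" if "set bs \<subseteq> Basis" for bs
    using that by (induction bs) (auto simp: assms)
  then show ?thesis by (auto simp: smooth_def diff)
qed

text \<open>The product rule yields sums of products, so a family closed under both differentiation
  and multiplication has to contain these.\<close>

inductive_set algebra_hull :: "('a::euclidean_space \<Rightarrow> complex) set \<Rightarrow> ('a \<Rightarrow> complex) set"
  for G where
  base: "\<phi> \<in> G \<Longrightarrow> \<phi> \<in> algebra_hull G"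
| add: "\<phi> \<in> algebra_hull G \<Longrightarrow> \<psi> \<in> algebra_hull G \<Longrightarrow> (\<lambda>x. \<phi> x + \<psi> x) \<in> algebra_hull G"
| mult: "\<phi> \<in> algebra_hull G \<Longrightarrow> \<psi> \<in> algebra_hull G \<Longrightarrow> (\<lambda>x. \<phi> x * \<psi> x) \<in> algebra_hull G"

text \<open>By the sum and product rules, differentiability and closure under partial derivatives
  pass from the generators to the hull, which then serves as the set in
  \<open>smooth_coinduct\<close>.\<close>

lemma smooth_algebra_hull:
  assumes diff: "\<And>\<phi> x. \<phi> \<in> G \<Longrightarrow> \<phi> differentiable (at x)"
    and part: "\<And>\<phi> b. \<phi> \<in> G \<Longrightarrow> b \<in> Basis \<Longrightarrow> partial b \<phi> \<in> algebra_hull G"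
    and "\<phi> \<in> algebra_hull G"
  shows "smooth \<phi>"
  using assms(3)
proof (rule smooth_coinduct)
  have *: "(\<forall>x. \<phi> differentiable (at x)) \<and> (\<forall>b\<in>Basis. partial b \<phi> \<in> algebra_hull G)"
    if "\<phi> \<in> algebra_hull G" for \<phi>
    using that
  proof induction
    case (base \<phi>)
    then show ?case using diff part by auto
  next
    case (add \<phi> \<psi>)
    have "partial b (\<lambda>x. \<phi> x + \<psi> x) = (\<lambda>x. partial b \<phi> x + partial b \<psi> x)" for b
    proof
      fix x
      obtain D D' where "(\<phi> has_derivative D) (at x)" "(\<psi> has_derivative D') (at x)"
        using add by (meson differentiable_def)
      then show "partial b (\<lambda>x. \<phi> x + \<psi> x) x = partial b \<phi> x + partial b \<psi> x"
        by (subst partial_eqI[OF has_derivative_add]) (auto simp: partial_eqI)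
    qed
    then show ?case using add by (auto intro: algebra_hull.add)
  next
    case (mult \<phi> \<psi>)
    have "partial b (\<lambda>x. \<phi> x * \<psi> x) = (\<lambda>x. \<phi> x * partial b \<psi> x + partial b \<phi> x * \<psi> x)" for b
    proof
      fix x
      obtain D D' where "(\<phi> has_derivative D) (at x)" "(\<psi> has_derivative D') (at x)"
        using mult by (meson differentiable_def)
      then show "partial b (\<lambda>x. \<phi> x * \<psi> x) x = \<phi> x * partial b \<psi> x + partial b \<phi> x * \<psi> x"
        by (subst partial_eqI[OF has_derivative_mult]) (auto simp: partial_eqI)
    qed
    then show ?case using mult by (auto intro!: algebra_hull.add algebra_hull.mult)
  qed
  show "\<And>\<phi> x. \<phi> \<in> algebra_hull G \<Longrightarrow> \<phi> differentiable (at x)"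
    and "\<And>\<phi> b. \<phi> \<in> algebra_hull G \<Longrightarrow> b \<in> Basis \<Longrightarrow> partial b \<phi> \<in> algebra_hull G"
    using * by auto
qed

section \<open>Products, linear combinations and affine substitutions\<close>

lemma smooth_mult: "smooth \<phi> \<Longrightarrow> smooth \<psi> \<Longrightarrow> smooth (\<lambda>x. \<phi> x * \<psi> x)"
  by (rule smooth_algebra_hull[of "Collect smooth"])
    (auto intro: algebra_hull.intros smooth_partial smooth_differentiable)

text \<open>The shape \<open>\<phi> x - c * \<psi> x\<close> covers differences (c = 1), scalar
  multiples (\<psi> = \<phi>, with 1 - c for c), and the error of an approximate identity whose
  kernel has integral c.\<close>

lemma partial_lincomb:
  assumes "smooth \<phi>" "smooth \<psi>"
  shows "partial b (\<lambda>x. \<phi> x - c * \<psi> x) = (\<lambda>x. partial b \<phi> x - c * partial b \<psi> x)"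
proof
  fix x
  obtain D D' where D: "(\<phi> has_derivative D) (at x)" "(\<psi> has_derivative D') (at x)"
    using assms by (meson differentiable_def smooth_differentiable)
  have "((\<lambda>x. \<phi> x - c * \<psi> x) has_derivative (\<lambda>z. D z - c * D' z)) (at x)"
    by (intro derivative_intros D)
  then show "partial b (\<lambda>x. \<phi> x - c * \<psi> x) x = partial b \<phi> x - c * partial b \<psi> x"
    by (simp add: partial_eqI D[THEN partial_eqI])
qed

lemma iter_partial_lincomb:
  assumes "smooth \<phi>" "smooth \<psi>" "set bs \<subseteq> Basis"
  shows "iter_partial bs (\<lambda>x. \<phi> x - c * \<psi> x) = (\<lambda>x. iter_partial bs \<phi> x - c * iter_partial bs \<psi> x)"
  using assms(3)
  by (induction bs) (auto simp: partial_lincomb smooth_iter_partial assms(1,2))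

lemma smooth_lincomb:
  assumes "smooth \<phi>" "smooth \<psi>" shows "smooth (\<lambda>x. \<phi> x - c * \<psi> x)"
  unfolding smooth_def
  using assms
  by (auto simp: iter_partial_lincomb intro!: differentiable_diff differentiable_mult dest: smooth_iter_differentiable)

text \<open>The prefactor \<open>k\<close> makes the form stable: differentiation only replaces
  \<open>k\<close> by \<open>k * of_real c\<close> and \<phi> by its partial derivative, so the rule
  can be iterated.\<close>

lemma partial_affine:
  assumes "smooth \<phi>"
  shows "partial b (\<lambda>x. k * \<phi> (c *\<^sub>R x + v)) = (\<lambda>x. k * of_real c * partial b \<phi> (c *\<^sub>R x + v))"
    and "(\<lambda>x. k * \<phi> (c *\<^sub>R x + v)) differentiable (at x)"
proof -
  have D: "((\<lambda>x. k * \<phi> (c *\<^sub>R x + v)) has_derivative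
      (\<lambda>z. k * (\<Sum>b\<in>Basis. ((c *\<^sub>R z + 0) \<bullet> b) *\<^sub>R partial b \<phi> (c *\<^sub>R x + v)))) (at x)" for x
    by (intro derivative_intros has_derivative_compose[OF _ smooth_has_derivative[OF assms],
        of "\<lambda>x. c *\<^sub>R x + v"])
  show "(\<lambda>x. k * \<phi> (c *\<^sub>R x + v)) differentiable (at x)"
    using D by (auto simp: differentiable_def)
  show "partial b (\<lambda>x. k * \<phi> (c *\<^sub>R x + v)) = (\<lambda>x. k * of_real c * partial b \<phi> (c *\<^sub>R x + v))"
  proof
    fix x
    have D1: "(\<phi> has_derivative (\<lambda>z. \<Sum>b\<in>Basis. (z \<bullet> b) *\<^sub>R partial b \<phi> (c *\<^sub>R x + v))) (at (c *\<^sub>R x + v))"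
      by (rule smooth_has_derivative[OF assms])
    have "(\<Sum>b'\<in>Basis. ((c *\<^sub>R b + 0) \<bullet> b') *\<^sub>R partial b' \<phi> (c *\<^sub>R x + v)) =
        c *\<^sub>R (\<Sum>b'\<in>Basis. (b \<bullet> b') *\<^sub>R partial b' \<phi> (c *\<^sub>R x + v))"
      by (simp add: scaleR_sum_right)
    also have "\<dots> = c *\<^sub>R partial b \<phi> (c *\<^sub>R x + v)"
      by (simp only: partial_eqI[OF D1, symmetric])
    finally show "partial b (\<lambda>x. k * \<phi> (c *\<^sub>R x + v)) x = k * of_real c * partial b \<phi> (c *\<^sub>R x + v)"
      unfolding partial_eqI[OF D] by (simp only: scaleR_conv_of_real mult.assoc)
  qed
qed

lemma iter_partial_affine:
  assumes "smooth \<phi>" "set bs \<subseteq> Basis"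
  shows "iter_partial bs (\<lambda>x. \<phi> (c *\<^sub>R x + v)) =
    (\<lambda>x. of_real (c ^ length bs) * iter_partial bs \<phi> (c *\<^sub>R x + v))"
  using assms(2)
proof (induction bs)
  case (Cons b bs)
  then have bs: "set bs \<subseteq> Basis" by simp
  show ?case
    unfolding iter_partial_Cons Cons.IH[OF bs]
      partial_affine(1)[OF smooth_iter_partial[OF assms(1) bs]]
    by (simp add: mult.commute[of "complex_of_real c"])
qed simp

lemma smooth_affine:
  assumes "smooth \<phi>"
  shows "smooth (\<lambda>x. \<phi> (c *\<^sub>R x + v))"
  unfolding smooth_def
proof (intro allI impI)
  fix bs :: "'a list" and x :: 'a assume "set bs \<subseteq> Basis"
  then show "iter_partial bs (\<lambda>x. \<phi> (c *\<^sub>R x + v)) differentiable (at x)"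
    by (simp only: iter_partial_affine[OF assms] partial_affine(2) smooth_iter_partial assms)
qed

text \<open>The functions \<open>flat p\<close> with \<open>p\<close> a polynomial are the derivatives of the standard flat
  function \<open>exp (-1/s)\<close>.\<close>

definition flat :: "real poly \<Rightarrow> real \<Rightarrow> real" where
  "flat p s = (if s > 0 then poly p (1/s) * exp (- (1/s)) else 0)"

lemma tendsto_poly_exp_0: "((\<lambda>y. poly p y * exp (- y)) \<longlongrightarrow> (0::real)) at_top"
proof -
  have "((\<lambda>y. \<Sum>i\<le>degree p. coeff p i * (y ^ i / exp y)) \<longlongrightarrow> (\<Sum>i\<le>degree p. coeff p i * 0)) at_top"
    by (intro tendsto_intros tendsto_power_div_exp_0)
  then show ?thesis
    by (simp add: poly_altdef exp_minus sum_distrib_right divide_inverse mult.assoc)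
qed

text \<open>With t = 1/s the chain rule multiplies the derivative of p(t) exp(-t), which is (p'(t) -
  p(t)) exp(-t), by -t^2; this explains the polynomial t^2 (p - p'). At s = 0 both one-sided
  difference quotients tend to 0.\<close>

lemma flat_has_derivative:
  "(flat p has_real_derivative flat ([:0, 0, 1:] * (p - pderiv p)) s) (at s)"
proof -
  consider "s > 0" | "s < 0" | "s = 0" by linarith
  then show ?thesis
  proof cases
    case 1
    define d where "d = - (1 / s^2)"
    have d: "((\<lambda>s. 1/s) has_real_derivative d) (at s)"
      unfolding d_def using 1 by (auto intro!: derivative_eq_intros simp: power2_eq_square)
    have "((\<lambda>s. poly p (1/s) * exp (- (1/s))) has_real_derivative
        poly (pderiv p) (1/s) * d * exp (- (1/s)) + exp (- (1/s)) * (- d) * poly p (1/s)) (at s)"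
      by (rule DERIV_mult[OF DERIV_chain2[OF poly_DERIV d] DERIV_chain2[OF DERIV_exp DERIV_minus[OF d]]])
    moreover have "poly (pderiv p) (1/s) * d * exp (- (1/s)) + exp (- (1/s)) * (- d) * poly p (1/s) =
        flat ([:0, 0, 1:] * (p - pderiv p)) s"
      using 1 by (simp add: flat_def d_def power2_eq_square algebra_simps)
    ultimately have "((\<lambda>s. poly p (1/s) * exp (- (1/s))) has_real_derivative
        flat ([:0, 0, 1:] * (p - pderiv p)) s) (at s)" by simp
    then show ?thesis
      by (rule has_field_derivative_transform_within_open[of _ _ _ "{0<..}"])
        (use 1 in \<open>auto simp: flat_def\<close>)
  next
    case 2
    have "((\<lambda>s. 0) has_real_derivative 0) (at s)" by simp
    then have "(flat p has_real_derivative 0) (at s)"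
      by (rule has_field_derivative_transform_within_open[of _ _ _ "{..<0}"])
        (use 2 in \<open>auto simp: flat_def\<close>)
    then show ?thesis using 2 by (simp add: flat_def)
  next
    case 3
    have "((\<lambda>h. flat p h / h) \<longlongrightarrow> 0) (at 0)"
    proof (rule filterlim_split_at)
      show "((\<lambda>h. flat p h / h) \<longlongrightarrow> 0) (at_left 0)"
        by (rule tendsto_eventually, rule eventually_at_leftI[of "-1"]) (auto simp: flat_def)
      \<comment> \<open>Dividing by h multiplies by 1/h, so p(t) becomes t p(t), which is
        \<open>pCons 0 p\<close>.\<close>
      have "((\<lambda>h. poly (pCons 0 p) (inverse h) * exp (- inverse h)) \<longlongrightarrow> 0) (at_right (0::real))"
        by (rule filterlim_compose[OF tendsto_poly_exp_0 filterlim_inverse_at_top_right])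
      then show "((\<lambda>h. flat p h / h) \<longlongrightarrow> 0) (at_right 0)"
        by (rule Lim_transform_eventually, intro eventually_at_rightI[of 0 1])
          (auto simp: flat_def field_simps)
    qed
    then show ?thesis using 3 by (simp add: DERIV_def flat_def)
  qed
qed

text \<open>The bump is the classical exp (-1 / (1 - |x|^2)) on the open unit ball and 0 elsewhere,
  written as \<open>flat 1\<close> composed with 1 - |x|^2.\<close>

lemma ex_smooth_bump:
  "\<exists>h::'a::euclidean_space \<Rightarrow> real. smooth (\<lambda>x. complex_of_real (h x)) \<and> (\<forall>x. 0 \<le> h x) \<and> 0 < h 0 \<and>
     (\<forall>x. 1 \<le> norm x \<longrightarrow> h x = 0)"
proof -
  define u :: "real poly \<Rightarrow> 'a \<Rightarrow> complex" where "u p x = of_real (flat p (1 - x \<bullet> x))" for p x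
  \<comment> \<open>A partial derivative of \<open>u p\<close> is the product of another
    \<open>u q\<close>, the constant -2 and a coordinate; with these three kinds of generators all
    derivatives stay in the hull.\<close>
  define G where "G = range u \<union> (\<Union>b. {\<lambda>x::'a. of_real (x \<bullet> b)}) \<union> (\<Union>c. {\<lambda>x::'a. c})"
  have u: "(u p has_derivative (\<lambda>z. u ([:0,0,1:] * (p - pderiv p)) x * of_real (- 2 * (x \<bullet> z)))) (at x)" for p x
  proof -
    define q where "q = [:0,0,1:] * (p - pderiv p)"
    have "(flat p has_derivative (\<lambda>y. y * flat q (1 - x \<bullet> x))) (at (1 - x \<bullet> x))"
      using flat_has_derivative[of p "1 - x \<bullet> x"]
      by (simp add: has_field_derivative_def q_def mult_commute_abs)
    then have "((\<lambda>x. flat p (1 - x \<bullet> x)) has_derivative (\<lambda>z. (0 - (x \<bullet> z + z \<bullet> x)) * flat q (1 - x \<bullet> x))) (at x)"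
      by (rule has_derivative_compose[rotated]) (intro derivative_intros)
    from has_derivative_of_real[OF this, where 'a=complex]
    have "((\<lambda>x. complex_of_real (flat p (1 - x \<bullet> x))) has_derivative
       (\<lambda>z. of_real ((0 - (x \<bullet> z + z \<bullet> x)) * flat q (1 - x \<bullet> x)))) (at x)" .
    then show ?thesis
      unfolding u_def q_def[symmetric]
      by (rule has_derivative_eq_rhs) (auto simp: inner_commute algebra_simps)
  qed
  have i: "((\<lambda>x::'a. complex_of_real (x \<bullet> b)) has_derivative (\<lambda>z. of_real (z \<bullet> b))) (at x)" for b x
    by (intro derivative_intros)
  have k: "((\<lambda>x::'a. c::complex) has_derivative (\<lambda>z. 0)) (at x)" for c x by simp
  have "smooth (u 1)"
  proof (rule smooth_algebra_hull[of G])
    fix \<phi> :: "'a \<Rightarrow> complex" and b x :: 'a assume "\<phi> \<in> G"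
    then consider p where "\<phi> = u p" | b where "\<phi> = (\<lambda>x. of_real (x \<bullet> b))" | c where "\<phi> = (\<lambda>x. c)"
      unfolding G_def by blast
    note cs = this
    show "\<phi> differentiable (at x)"
      using cs differentiableI[OF u] differentiableI[OF i] differentiableI[OF k] by metis
    show "partial b \<phi> \<in> algebra_hull G"
    proof (cases rule: cs)
      case (1 p)
      have *: "partial b \<phi> = (\<lambda>x. u ([:0,0,1:] * (p - pderiv p)) x * ((\<lambda>_. -2) x * (\<lambda>x. of_real (x \<bullet> b)) x))"
        unfolding 1 by (rule ext, subst partial_eqI[OF u]) simp
      show ?thesis unfolding * by (intro algebra_hull.mult algebra_hull.base) (unfold G_def, blast+)
    next
      case (2 b')
      have *: "partial b \<phi> = (\<lambda>x. of_real (b \<bullet> b'))"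
        unfolding 2 by (rule ext, subst partial_eqI[OF i]) simp
      show ?thesis unfolding * by (intro algebra_hull.base) (unfold G_def, blast)
    next
      case (3 c)
      have *: "partial b \<phi> = (\<lambda>x. 0)"
        unfolding 3 by (rule ext, subst partial_eqI[OF k]) simp
      show ?thesis unfolding * by (intro algebra_hull.base) (unfold G_def, blast)
    qed
  next
    show "u 1 \<in> algebra_hull G" by (intro algebra_hull.base) (auto simp: G_def)
  qed
  moreover have "flat 1 s \<ge> 0" for s by (simp add: flat_def)
  moreover have "flat 1 1 > 0" by (simp add: flat_def)
  moreover have "flat 1 (1 - x \<bullet> x) = 0" if "1 \<le> norm x" for x :: 'a
    using one_le_power[OF that, of 2] by (simp add: flat_def dot_square_norm not_less)
  ultimately show ?thesis
    by (intro exI[of _ "\<lambda>x. flat 1 (1 - x \<bullet> x)"]) (auto simp: u_def[abs_def])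
qed

section \<open>Schwartz functions\<close>

text \<open>A Peetre-type inequality. It exchanges decay at y for decay at x, at the price of
  polynomial growth in x - y.\<close>

lemma weight_le: "1 + norm x \<le> (1 + norm y) * (1 + norm (x - y))" for x y :: "'a::real_normed_vector"
proof -
  have "norm x \<le> norm y + norm (x - y)" by (metis norm_triangle_sub)
  also have "\<dots> \<le> norm y + norm (x - y) + norm y * norm (x - y)" by simp
  finally show ?thesis by (simp add: algebra_simps)
qed

lemma inverse_weight_le:
  "1 / (1 + norm (y::'a::real_normed_vector)) ^ k \<le> (1 + norm (x - y)) ^ k / (1 + norm x) ^ k"
proof -
  have "(1 + norm x) ^ k \<le> ((1 + norm y) * (1 + norm (x - y))) ^ k"
    by (intro power_mono weight_le) auto
  then have "(1 + norm x) ^ k \<le> (1 + norm y) ^ k * (1 + norm (x - y)) ^ k"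
    by (simp only: power_mult_distrib)
  moreover have "0 < (1 + norm x) ^ k" "0 < (1 + norm y) ^ k" by (auto simp: add_pos_nonneg)
  ultimately show ?thesis by (simp add: divide_simps mult.commute)
qed

lemma schwartz_smooth: "\<phi> \<in> schwartz \<Longrightarrow> smooth \<phi>"
  by (simp add: schwartz_def)

lemma schwartzI:
  assumes "smooth \<phi>"
    and "\<And>k bs. set bs \<subseteq> Basis \<Longrightarrow> \<exists>C. \<forall>x. (1 + norm x) ^ k * norm (iter_partial bs \<phi> x) \<le> C"
  shows "\<phi> \<in> schwartz"
  using assms by (auto simp: schwartz_def bdd_above_def)

lemma schwartz_decay:
  assumes "\<phi> \<in> schwartz" "set bs \<subseteq> Basis"
  obtains C where "C \<ge> 0" "\<And>x. (1 + norm x) ^ k * norm (iter_partial bs \<phi> x) \<le> C"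
proof -
  obtain C where C: "\<And>x. (1 + norm x) ^ k * norm (iter_partial bs \<phi> x) \<le> C"
  proof -
    have "bdd_above (range (\<lambda>x. (1 + norm x) ^ k * norm (iter_partial bs \<phi> x)))"
      using assms by (simp add: schwartz_def)
    then show ?thesis using that by (auto simp: bdd_above_def)
  qed
  have "0 \<le> (1 + norm (0::'a)) ^ k * norm (iter_partial bs \<phi> 0)" by simp
  also have "\<dots> \<le> C" by (rule C)
  finally show ?thesis using C that by blast
qed

lemma schwartz_iter_partial:
  assumes "\<phi> \<in> schwartz" "set bs \<subseteq> Basis" shows "iter_partial bs \<phi> \<in> schwartz"
proof (rule schwartzI)
  show "smooth (iter_partial bs \<phi>)" using assms by (simp add: schwartz_smooth smooth_iter_partial)
  fix k and cs :: "'a list" assume "set cs \<subseteq> Basis"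
  then show "\<exists>C. \<forall>x. (1 + norm x) ^ k * norm (iter_partial cs (iter_partial bs \<phi>) x) \<le> C"
    using schwartz_decay[OF assms(1), of "cs @ bs" k] assms(2)
    by (metis iter_partial_append le_sup_iff set_append)
qed

lemma schwartz_partial: "\<phi> \<in> schwartz \<Longrightarrow> b \<in> Basis \<Longrightarrow> partial b \<phi> \<in> schwartz"
  using schwartz_iter_partial[of \<phi> "[b]"] by simp

text \<open>This supplies the test functions in the definition of s-almost periodicity. Moving the
  weight from x to t - x costs a factor (1 + |t|)^k.\<close>

lemma schwartz_reflect:
  assumes "\<phi> \<in> schwartz" shows "(\<lambda>x. \<phi> (t - x)) \<in> schwartz"
proof (rule schwartzI)
  have eq: "(\<lambda>x. \<phi> (t - x)) = (\<lambda>x. \<phi> ((-1) *\<^sub>R x + t))" by simp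
  show "smooth (\<lambda>x. \<phi> (t - x))"
    unfolding eq by (intro smooth_affine schwartz_smooth assms)
  fix k and bs :: "'a list" assume bs: "set bs \<subseteq> Basis"
  obtain C where C: "C \<ge> 0" "\<And>x. (1 + norm x) ^ k * norm (iter_partial bs \<phi> x) \<le> C"
    using schwartz_decay[OF assms bs] by blast
  have "(1 + norm x) ^ k * norm (iter_partial bs (\<lambda>x. \<phi> (t - x)) x) \<le> (1 + norm t) ^ k * C" for x
  proof -
    have "(1 + norm x) ^ k \<le> ((1 + norm (t - x)) * (1 + norm t)) ^ k"
      using weight_le[of x "x - t"] by (intro power_mono) (auto simp: norm_minus_commute)
    from mult_right_mono[OF this norm_ge_zero[of "iter_partial bs \<phi> (t - x)"]]
    have "(1 + norm x) ^ k * norm (iter_partial bs \<phi> (t - x)) \<le>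
      (1 + norm t) ^ k * ((1 + norm (t - x)) ^ k * norm (iter_partial bs \<phi> (t - x)))"
      by (simp only: power_mult_distrib mult_ac)
    also have "\<dots> \<le> (1 + norm t) ^ k * C"
      by (intro mult_left_mono C) auto
    finally show ?thesis
      unfolding eq iter_partial_affine[OF schwartz_smooth[OF assms] bs] by (simp add: norm_mult norm_power)
  qed
  then show "\<exists>C. \<forall>x. (1 + norm x) ^ k * norm (iter_partial bs (\<lambda>x. \<phi> (t - x)) x) \<le> C" by blast
qed

section \<open>Test functions of compact support\<close>

lemma partial_eq_0_outside:
  assumes "open U" "x \<in> U" "\<And>y. y \<in> U \<Longrightarrow> \<phi> y = 0"
  shows "partial b \<phi> x = 0"
proof -
  have "((\<lambda>_. 0) has_derivative (\<lambda>_. 0)) (at x)" by simp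
  then have "(\<phi> has_derivative (\<lambda>_. 0)) (at x)"
    using assms by (metis has_derivative_transform_within_open)
  then show ?thesis by (simp add: partial_eqI)
qed

text \<open>The complement of the closed support is open, so all derivatives vanish there as well;
  on the compact support the weighted derivatives are bounded by continuity.\<close>

lemma compact_support_schwartz:
  assumes "smooth \<phi>" "compact (closure {x. \<phi> x \<noteq> 0})"
  shows "\<phi> \<in> schwartz"
proof (rule schwartzI[OF assms(1)])
  fix k and bs :: "'a list" assume bs: "set bs \<subseteq> Basis"
  let ?K = "closure {x. \<phi> x \<noteq> 0}"
  have out: "iter_partial bs \<phi> x = 0" if "x \<notin> ?K" for x
    using that
  proof (induction bs arbitrary: x)
    case Nil
    then show ?case using closure_subset by force
  next
    case (Cons b bs)
    then show ?case
      using partial_eq_0_outside[of "- ?K" x "iter_partial bs \<phi>" b] by (simp add: open_Compl)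
  qed
  have "continuous_on ?K (\<lambda>x. (1 + norm x) ^ k * norm (iter_partial bs \<phi> x))"
    by (intro continuous_intros smooth_continuous_on smooth_iter_partial assms(1) bs)
  then have "bdd_above ((\<lambda>x. (1 + norm x) ^ k * norm (iter_partial bs \<phi> x)) ` ?K)"
    using assms(2) by (intro bounded_imp_bdd_above compact_imp_bounded compact_continuous_image)
  then obtain C where C: "\<And>x. x \<in> ?K \<Longrightarrow> (1 + norm x) ^ k * norm (iter_partial bs \<phi> x) \<le> C"
    by (auto simp: bdd_above_def)
  \<comment> \<open>The maximum with 0 serves the points outside the support: \<open>C\<close> may
    be negative when the support is empty.\<close>
  have "(1 + norm x) ^ k * norm (iter_partial bs \<phi> x) \<le> max C 0" for x
    by (cases "x \<in> ?K") (use C out in \<open>auto simp: le_max_iff_disj\<close>)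
  then show "\<exists>C. \<forall>x. (1 + norm x) ^ k * norm (iter_partial bs \<phi> x) \<le> C" by blast
qed

section \<open>Mean value and Taylor estimates with polynomial weights\<close>

lemma onorm_partials_le:
  assumes "\<And>b. b \<in> Basis \<Longrightarrow> norm (p b :: complex) \<le> C b"
  shows "onorm (\<lambda>z::'a::euclidean_space. \<Sum>b\<in>Basis. (z \<bullet> b) *\<^sub>R p b) \<le> (\<Sum>b\<in>Basis. C b)"
proof (rule onorm_le)
  fix z :: 'a
  have "norm (\<Sum>b\<in>Basis. (z \<bullet> b) *\<^sub>R p b) \<le> (\<Sum>b\<in>Basis. norm z * C b)"
    by (rule sum_norm_le) (auto intro!: mult_mono assms simp: Basis_le_norm)
  then show "norm (\<Sum>b\<in>Basis. (z \<bullet> b) *\<^sub>R p b) \<le> (\<Sum>b\<in>Basis. C b) * norm z"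
    by (simp add: sum_distrib_left mult.commute)
qed

text \<open>The mean value inequality on the segment from x to x + z. The partial derivatives decay
  at the intermediate point y, and \<open>inverse_weight_le\<close> carries this decay to x. The
  increment z is unrestricted, since convolution integrates over all shifts.\<close>

lemma schwartz_lipschitz:
  fixes \<phi> :: "'a::euclidean_space \<Rightarrow> complex"
  assumes "\<phi> \<in> schwartz"
  obtains C where "C \<ge> 0"
    "\<And>x z. norm (\<phi> (x + z) - \<phi> x) \<le> C * (norm z * (1 + norm z) ^ k / (1 + norm x) ^ k)"
proof -
  have "\<exists>C\<ge>0. \<forall>x. (1 + norm x) ^ k * norm (partial b \<phi> x) \<le> C" if "b \<in> Basis" for b
    using schwartz_decay[OF assms, of "[b]" k] that by auto
  then obtain C where C: "\<And>b. b \<in> Basis \<Longrightarrow> C b \<ge> 0"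
    "\<And>b x. b \<in> Basis \<Longrightarrow> (1 + norm x) ^ k * norm (partial b \<phi> x) \<le> C b"
    by metis
  have "norm (\<phi> (x + z) - \<phi> x) \<le> (\<Sum>b\<in>Basis. C b) * (norm z * (1 + norm z) ^ k / (1 + norm x) ^ k)" for x z
  proof -
    let ?B = "\<Sum>b\<in>Basis. C b * ((1 + norm z) ^ k / (1 + norm x) ^ k)"
    have "norm (\<phi> (x + z) - \<phi> x) \<le> ?B * norm (x + z - x)"
    proof (rule differentiable_bound[of "closed_segment x (x + z)"])
      fix y assume y: "y \<in> closed_segment x (x + z)"
      show "(\<phi> has_derivative (\<lambda>z. \<Sum>b\<in>Basis. (z \<bullet> b) *\<^sub>R partial b \<phi> y))
          (at y within closed_segment x (x + z))"
        by (rule has_derivative_at_withinI[OF smooth_has_derivative[OF schwartz_smooth[OF assms]]])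
      have yx: "norm (x - y) \<le> norm z"
        using segment_bound1[OF y] by (simp add: norm_minus_commute)
      show "onorm (\<lambda>z. \<Sum>b\<in>Basis. (z \<bullet> b) *\<^sub>R partial b \<phi> y) \<le> ?B"
      proof (rule onorm_partials_le)
        fix b :: 'a assume b: "b \<in> Basis"
        have "norm (partial b \<phi> y) \<le> C b * (1 / (1 + norm y) ^ k)"
          using C(2)[OF b, of y] by (simp add: field_simps add_pos_nonneg)
        also have "1 / (1 + norm y) ^ k \<le> (1 + norm (x - y)) ^ k / (1 + norm x) ^ k"
          by (rule inverse_weight_le)
        also have "\<dots> \<le> (1 + norm z) ^ k / (1 + norm x) ^ k"
          using yx by (intro divide_right_mono power_mono) auto
        finally show "norm (partial b \<phi> y) \<le> C b * ((1 + norm z) ^ k / (1 + norm x) ^ k)"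
          using C(1)[OF b] by (simp add: mult_left_mono)
      qed
    qed auto
    also have "?B * norm (x + z - x) = (\<Sum>b\<in>Basis. C b) * (norm z * (1 + norm z) ^ k / (1 + norm x) ^ k)"
      by (subst sum_distrib_right[symmetric]) (simp add: divide_inverse mult_ac)
    finally show ?thesis .
  qed
  then show ?thesis using that[of "\<Sum>b\<in>Basis. C b"] C(1) by (simp add: sum_nonneg)
qed

text \<open>The mean value inequality for the linearization at x, with the variation of the
  derivative along the segment controlled by \<open>schwartz_lipschitz\<close> for each partial
  derivative; this gives the second factor |z|.\<close>

lemma schwartz_taylor:
  fixes \<phi> :: "'a::euclidean_space \<Rightarrow> complex"
  assumes "\<phi> \<in> schwartz"
  obtains C where "C \<ge> 0"
    "\<And>x z. norm (\<phi> (x + z) - \<phi> x - (\<Sum>b\<in>Basis. (z \<bullet> b) *\<^sub>R partial b \<phi> x)) \<le>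
       C * ((norm z)\<^sup>2 * (1 + norm z) ^ k / (1 + norm x) ^ k)"
proof -
  have "\<exists>C\<ge>0. \<forall>x z. norm (partial b \<phi> (x + z) - partial b \<phi> x) \<le> C * (norm z * (1 + norm z) ^ k / (1 + norm x) ^ k)"
    if "b \<in> Basis" for b
    by (rule schwartz_lipschitz[OF schwartz_partial[OF assms that], of k]) blast
  then have "\<forall>b\<in>Basis. \<exists>C. C \<ge> 0 \<and> (\<forall>x z. norm (partial b \<phi> (x + z) - partial b \<phi> x) \<le>
      C * (norm z * (1 + norm z) ^ k / (1 + norm x) ^ k))" by simp
  from bchoice[OF this] obtain C where C: "\<And>b. b \<in> Basis \<Longrightarrow> C b \<ge> 0"
    "\<And>b x z. b \<in> Basis \<Longrightarrow>
      norm (partial b \<phi> (x + z) - partial b \<phi> x) \<le> C b * (norm z * (1 + norm z) ^ k / (1 + norm x) ^ k)"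
    by blast
  have "norm (\<phi> (x + z) - \<phi> x - (\<Sum>b\<in>Basis. (z \<bullet> b) *\<^sub>R partial b \<phi> x)) \<le>
    (\<Sum>b\<in>Basis. C b) * ((norm z)\<^sup>2 * (1 + norm z) ^ k / (1 + norm x) ^ k)" for x z
  proof -
    let ?B = "\<Sum>b\<in>Basis. C b * (norm z * (1 + norm z) ^ k / (1 + norm x) ^ k)"
    let ?D = "\<lambda>y z. \<Sum>b\<in>Basis. (z \<bullet> b) *\<^sub>R partial b \<phi> y"
    have "norm (\<phi> (x + z) - \<phi> x - ?D x (x + z - x)) \<le> norm (x + z - x) * ?B"
    proof (rule differentiable_bound_linearization[of _ _ "closed_segment x (x + z)"])
      fix t :: real assume "t \<in> {0..1}"
      then show "x + t *\<^sub>R (x + z - x) \<in> closed_segment x (x + z)"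
        unfolding in_segment by (intro exI[of _ t]) (simp add: scaleR_diff_left scaleR_add_right)
    next
      fix y assume y: "y \<in> closed_segment x (x + z)"
      show "(\<phi> has_derivative ?D y) (at y within closed_segment x (x + z))"
        by (rule has_derivative_at_withinI[OF smooth_has_derivative[OF schwartz_smooth[OF assms]]])
      have yx: "norm (y - x) \<le> norm z"
        using segment_bound1[OF y] by (simp add: norm_minus_commute)
      have eq: "?D y - ?D x = (\<lambda>z. \<Sum>b\<in>Basis. (z \<bullet> b) *\<^sub>R (partial b \<phi> y - partial b \<phi> x))"
        by (simp add: fun_eq_iff scaleR_diff_right sum_subtractf)
      show "onorm (?D y - ?D x) \<le> ?B"
        unfolding eq
      proof (rule onorm_partials_le)
        fix b :: 'a assume b: "b \<in> Basis"
        have "norm (partial b \<phi> y - partial b \<phi> x) \<le> C b * (norm (y - x) * (1 + norm (y - x)) ^ k / (1 + norm x) ^ k)"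
          using C(2)[OF b, of x "y - x"] by simp
        also have "\<dots> \<le> C b * (norm z * (1 + norm z) ^ k / (1 + norm x) ^ k)"
          using yx C(1)[OF b] by (intro mult_left_mono divide_right_mono mult_mono power_mono) auto
        finally show "norm (partial b \<phi> y - partial b \<phi> x) \<le> \<dots>" .
      qed
    qed auto
    also have "norm (x + z - x) * ?B = (\<Sum>b\<in>Basis. C b) * ((norm z)\<^sup>2 * (1 + norm z) ^ k / (1 + norm x) ^ k)"
      by (subst sum_distrib_right[symmetric]) (simp add: divide_inverse power2_eq_square mult_ac)
    finally show ?thesis by simp
  qed
  then show ?thesis using that[of "\<Sum>b\<in>Basis. C b"] C(1) by (simp add: sum_nonneg)
qed

section \<open>Integration of rapidly decreasing functions\<close>

text \<open>The exponent m + 2 leaves the convergent series of 1 / (n + 1)^2 after the mass (n +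
  1)^m of the ball of radius n + 1 is taken into account. The measure is arbitrary so that the bound
  serves both Lebesgue measure and the atoms of the given measure.\<close>

lemma integrable_weight:
  fixes M :: "'a::euclidean_space measure"
  assumes M: "sets M = sets borel"
    and growth: "\<And>n::nat. emeasure M (ball 0 (real n + 1)) \<le> ennreal (C * (real n + 1) ^ m)"
    and "C \<ge> 0"
  shows "integrable M (\<lambda>x. 1 / (1 + norm x) ^ (m + 2))"
proof (rule integrableI_bounded)
  have [measurable_cong]: "sets M = sets borel" by (rule M)
  show "(\<lambda>x. 1 / (1 + norm x) ^ (m + 2)) \<in> borel_measurable M" by measurable
  define w where "w n = 1 / (real n + 1) ^ (m + 2)" for n
  have "(\<integral>\<^sup>+x. ennreal (norm (1 / (1 + norm x) ^ (m + 2))) \<partial>M) \<le>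
    (\<integral>\<^sup>+x. (\<Sum>n. ennreal (w n) * indicator (ball 0 (real n + 1)) x) \<partial>M)"
  proof (rule nn_integral_mono)
    fix x :: 'a
    \<comment> \<open>The single ball with this index already dominates the integrand at x; the
      other summands only enlarge the upper bound.\<close>
    define n where "n = nat \<lfloor>norm x\<rfloor>"
    have n: "real n \<le> norm x" "norm x < real n + 1" by (simp_all add: n_def)
    have "ennreal (norm (1 / (1 + norm x) ^ (m + 2))) \<le> ennreal (w n)"
    proof -
      have "(real n + 1) ^ (m + 2) \<le> (1 + norm x) ^ (m + 2)" by (rule power_mono) (use n in auto)
      moreover have "0 < (real n + 1) ^ (m + 2)" by (simp add: add_pos_nonneg)
      ultimately show ?thesis
        unfolding w_def by (intro ennreal_leI) (simp add: frac_le del: power_add power_Suc)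
    qed
    also have "\<dots> = (\<Sum>k\<in>{n}. ennreal (w k) * indicator (ball 0 (real k + 1)) x)"
      using n by simp
    also have "\<dots> \<le> (\<Sum>n. ennreal (w n) * indicator (ball 0 (real n + 1)) x)"
      by (rule sum_le_suminf) auto
    finally show "ennreal (norm (1 / (1 + norm x) ^ (m + 2))) \<le> \<dots>" .
  qed
  also have "\<dots> = (\<Sum>n. ennreal (w n) * emeasure M (ball 0 (real n + 1)))"
    by (subst nn_integral_suminf, measurable) (auto simp: nn_integral_cmult_indicator M)
  also have "\<dots> \<le> (\<Sum>n. ennreal (C * (1 / (real n + 1)\<^sup>2)))"
  proof (rule suminf_le)
    fix n
    have "ennreal (w n) * emeasure M (ball 0 (real n + 1)) \<le> ennreal (w n) * ennreal (C * (real n + 1) ^ m)"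
      by (intro mult_left_mono growth) auto
    also have "\<dots> = ennreal (C * (1 / (real n + 1)\<^sup>2))"
      by (subst ennreal_mult'[symmetric]) (auto simp: w_def power_add power2_eq_square add_pos_nonneg)
    finally show "ennreal (w n) * emeasure M (ball 0 (real n + 1)) \<le> \<dots>" .
  qed auto
  also have "\<dots> < \<infinity>"
  proof -
    have "summable (\<lambda>n. 1 / (real n + 1)\<^sup>2)"
      using summable_Suc_iff[of "\<lambda>n. inverse (real n ^ 2)"] inverse_power_summable[of 2, where 'a=real]
      by (simp add: field_simps)
    then have "summable (\<lambda>n. C * (1 / (real n + 1)\<^sup>2))" by (rule summable_mult)
    then have "(\<Sum>n. ennreal (C * (1 / (real n + 1)\<^sup>2))) \<noteq> top"
      by (rule ennreal_suminf_neq_top) (use \<open>C \<ge> 0\<close> in simp)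
    then show ?thesis by (simp only: infinity_ennreal_def less_top)
  qed
  finally show "(\<integral>\<^sup>+x. ennreal (norm (1 / (1 + norm x) ^ (m + 2))) \<partial>M) < \<infinity>" .
qed

lemma integrable_weight_lborel:
  "integrable lborel (\<lambda>x::'a::euclidean_space. 1 / (1 + norm x) ^ (DIM('a) + 2))"
  by (rule integrable_weight[where C="unit_ball_vol DIM('a)"]) (auto simp: emeasure_ball)

text \<open>Decay of the function alone, without derivatives. The class is closed under
  multiplication by coordinates, which is how differentiating a Fourier transform acts on the
  original function, and it has all the moments required of a convolution kernel.\<close>

definition rapid :: "('a::euclidean_space \<Rightarrow> complex) \<Rightarrow> bool" where
  "rapid \<eta> \<longleftrightarrow> \<eta> \<in> borel_measurable borel \<and> (\<forall>k. \<exists>C. \<forall>x. (1 + norm x) ^ k * norm (\<eta> x) \<le> C)"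

lemma rapid_measurable[measurable_dest]: "rapid \<eta> \<Longrightarrow> \<eta> \<in> borel_measurable borel"
  by (simp add: rapid_def)

text \<open>A further \<open>DIM('a) + 2\<close> powers of decay make the remaining weight
  integrable.\<close>

lemma rapid_moment:
  fixes \<eta> :: "'a::euclidean_space \<Rightarrow> complex"
  assumes "rapid \<eta>"
  shows "integrable lborel (\<lambda>x. (1 + norm x) ^ k * norm (\<eta> x))"
proof -
  have [measurable]: "\<eta> \<in> borel_measurable borel" using assms by (rule rapid_measurable)
  obtain C where C: "\<And>x. (1 + norm x) ^ (k + (DIM('a) + 2)) * norm (\<eta> x) \<le> C"
    using assms unfolding rapid_def by blast
  show ?thesis
  proof (rule Bochner_Integration.integrable_bound)
    show "integrable lborel (\<lambda>x::'a. C * (1 / (1 + norm x) ^ (DIM('a) + 2)))"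
      by (intro integrable_mult_right integrable_weight_lborel)
    have "norm ((1 + norm x) ^ k * norm (\<eta> x)) \<le> norm (C * (1 / (1 + norm x) ^ (DIM('a) + 2)))" for x
    proof -
      have "0 < (1 + norm x) ^ (DIM('a) + 2)" by (simp only: zero_less_power add_pos_nonneg norm_ge_zero zero_less_one)
      then have "(1 + norm x) ^ k * norm (\<eta> x) \<le> C * (1 / (1 + norm x) ^ (DIM('a) + 2))"
        using C[of x] unfolding power_add[of _ k] by (simp add: pos_le_divide_eq mult_ac del: power_add power_add_numeral)
      moreover have "0 \<le> (1 + norm x) ^ k * norm (\<eta> x)" by simp
      ultimately show ?thesis unfolding real_norm_def by linarith
    qed
    then show "AE x in lborel. norm ((1 + norm x) ^ k * norm (\<eta> x)) \<le> norm (C * (1 / (1 + norm x) ^ (DIM('a) + 2)))"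
      by simp
  qed simp
qed

lemma rapid_integrable: "rapid \<eta> \<Longrightarrow> integrable lborel \<eta>"
  using rapid_moment[of \<eta> 0] integrable_norm_iff[of \<eta> lborel] rapid_measurable[of \<eta>] by simp

lemma schwartz_rapid: "\<phi> \<in> schwartz \<Longrightarrow> rapid \<phi>"
  unfolding rapid_def
proof (intro conjI allI)
  assume \<phi>: "\<phi> \<in> schwartz"
  show "\<phi> \<in> borel_measurable borel"
    by (intro borel_measurable_continuous_onI smooth_continuous_on schwartz_smooth \<phi>)
  show "\<exists>C. \<forall>x. (1 + norm x) ^ k * norm (\<phi> x) \<le> C" for k
    by (rule schwartz_decay[OF \<phi>, of "[]" k]) auto
qed

lemma rapid_mult_linear:
  assumes "rapid \<eta>" shows "rapid (\<lambda>x. c * of_real (x \<bullet> b) * \<eta> x)"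
  unfolding rapid_def
proof (intro conjI allI)
  have [measurable]: "\<eta> \<in> borel_measurable borel" using assms by (rule rapid_measurable)
  show "(\<lambda>x. c * of_real (x \<bullet> b) * \<eta> x) \<in> borel_measurable borel" by measurable
  fix k
  obtain C where C: "\<And>x. (1 + norm x) ^ Suc k * norm (\<eta> x) \<le> C"
    using assms unfolding rapid_def by blast
  have "(1 + norm x) ^ k * norm (c * of_real (x \<bullet> b) * \<eta> x) \<le> norm c * norm b * C" for x
  proof -
    have "norm (complex_of_real (x \<bullet> b)) \<le> (1 + norm x) * norm b"
      using Cauchy_Schwarz_ineq2[of x b] norm_ge_zero[of b] by (auto simp: algebra_simps intro: order_trans)
    then have "(1 + norm x) ^ k * norm (c * of_real (x \<bullet> b) * \<eta> x) \<le>
      (1 + norm x) ^ k * (norm c * ((1 + norm x) * norm b) * norm (\<eta> x))"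
      unfolding norm_mult by (intro mult_left_mono mult_right_mono) auto
    also have "\<dots> = norm c * norm b * ((1 + norm x) ^ Suc k * norm (\<eta> x))" by simp
    also have "\<dots> \<le> norm c * norm b * C" by (intro mult_left_mono C) auto
    finally show ?thesis .
  qed
  then show "\<exists>C. \<forall>x. (1 + norm x) ^ k * norm (c * of_real (x \<bullet> b) * \<eta> x) \<le> C" by blast
qed

text \<open>Integrating the second-order bound gives an error of at most |z|^2 times a constant,
  hence o(|z|). In this form of differentiation under the integral sign the remainder estimate plays
  the part of a dominating function.\<close>

lemma has_derivative_integral:
  fixes K :: "'a::euclidean_space \<Rightarrow> 'b \<Rightarrow> complex"
  assumes K: "\<And>x. integrable M (K x)"
    and P: "\<And>b. b \<in> Basis \<Longrightarrow> integrable M (P b)"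
    and B: "integrable M B"
    and taylor: "\<And>z v. norm z \<le> 1 \<Longrightarrow>
      norm (K (x + z) v - K x v - (\<Sum>b\<in>Basis. (z \<bullet> b) *\<^sub>R P b v)) \<le> (norm z)\<^sup>2 * B v"
  shows "((\<lambda>x. \<integral>v. K x v \<partial>M) has_derivative (\<lambda>z. \<Sum>b\<in>Basis. (z \<bullet> b) *\<^sub>R (\<integral>v. P b v \<partial>M))) (at x)"
  unfolding has_derivative_at_alt
proof (intro conjI allI impI)
  show "bounded_linear (\<lambda>z. \<Sum>b\<in>Basis. (z \<bullet> b) *\<^sub>R (\<integral>v. P b v \<partial>M))"
    by (intro bounded_linear_sum bounded_linear_scaleR_const bounded_linear_inner_left)
  let ?F = "\<lambda>x. \<integral>v. K x v \<partial>M" and ?L = "\<lambda>z. \<Sum>b\<in>Basis. (z \<bullet> b) *\<^sub>R (\<integral>v. P b v \<partial>M)"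
  \<comment> \<open>The summand 1 keeps \<open>I\<close> positive, so that \<open>e / I\<close> is a
    valid radius.\<close>
  define I where "I = \<bar>\<integral>v. B v \<partial>M\<bar> + 1"
  have I: "I > 0" by (simp add: I_def)
  have est: "norm (?F (x + z) - ?F x - ?L z) \<le> (norm z)\<^sup>2 * I" if "norm z \<le> 1" for z
  proof -
    have "?F (x + z) - ?F x - ?L z =
      (\<integral>v. K (x + z) v - K x v - (\<Sum>b\<in>Basis. (z \<bullet> b) *\<^sub>R P b v) \<partial>M)"
      using K P by (simp add: Bochner_Integration.integral_diff Bochner_Integration.integrable_diff integral_sum integrable_sum)
    also have "norm \<dots> \<le> (\<integral>v. (norm z)\<^sup>2 * B v \<partial>M)"
    proof (rule order_trans[OF integral_norm_bound integral_mono])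
      show "integrable M (\<lambda>v. norm (K (x + z) v - K x v - (\<Sum>b\<in>Basis. (z \<bullet> b) *\<^sub>R P b v)))"
        by (intro integrable_norm Bochner_Integration.integrable_diff Bochner_Integration.integrable_sum
            integrable_scaleR_right K P)
    qed (use B taylor[OF that] in auto)
    also have "\<dots> = (norm z)\<^sup>2 * (\<integral>v. B v \<partial>M)" by simp
    also have "\<dots> \<le> (norm z)\<^sup>2 * I" by (intro mult_left_mono) (auto simp: I_def)
    finally show ?thesis .
  qed
  fix e :: real assume "e > 0"
  have "norm (?F y - ?F x - ?L (y - x)) \<le> e * norm (y - x)" if "norm (y - x) < min 1 (e / I)" for y
  proof -
    have "norm (?F y - ?F x - ?L (y - x)) \<le> (norm (y - x) * I) * norm (y - x)"
      using est[of "y - x"] that by (simp add: power2_eq_square mult_ac)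
    also have "\<dots> \<le> e * norm (y - x)"
      using that I by (intro mult_right_mono) (auto simp: field_simps)
    finally show ?thesis .
  qed
  then show "\<exists>d>0. \<forall>y. norm (y - x) < d \<longrightarrow> norm (?F y - ?F x - ?L (y - x)) \<le> e * norm (y - x)"
    using \<open>e > 0\<close> I by (intro exI[of _ "min 1 (e / I)"]) auto
qed

section \<open>The Fourier transform\<close>

lemma norm_cis_minus_1: "norm (cis s - 1) \<le> \<bar>s\<bar>"
proof -
  have "norm (cis s - cis 0) \<le> 1 * norm (s - 0)"
  proof (rule differentiable_bound[of UNIV])
    fix t :: real
    show "(cis has_derivative (\<lambda>z. z *\<^sub>R (\<i> * cis t))) (at t within UNIV)"
      by (auto intro!: derivative_eq_intros simp: scaleR_conv_of_real)
    show "onorm (\<lambda>z. z *\<^sub>R (\<i> * cis t)) \<le> 1"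
      by (rule onorm_le) (simp add: norm_mult)
  qed auto
  then show ?thesis by simp
qed

text \<open>The function cis t - \<i> t has derivative \<i> (cis t - 1), whose modulus between 0 and
  s is at most |s| by \<open>norm_cis_minus_1\<close>.\<close>

lemma norm_cis_taylor: "norm (cis s - 1 - \<i> * of_real s) \<le> s\<^sup>2"
proof -
  have "norm ((cis s - \<i> * of_real s) - (cis 0 - \<i> * of_real 0)) \<le> \<bar>s\<bar> * norm (s - 0)"
  proof (rule differentiable_bound[of "closed_segment 0 s"])
    fix t assume "t \<in> closed_segment 0 s"
    then have t: "\<bar>t\<bar> \<le> \<bar>s\<bar>" by (auto simp: closed_segment_eq_real_ivl split: if_splits)
    show "((\<lambda>t. cis t - \<i> * of_real t) has_derivative (\<lambda>z. z *\<^sub>R (\<i> * (cis t - 1)))) (at t within closed_segment 0 s)"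
      by (auto intro!: derivative_eq_intros simp: scaleR_conv_of_real algebra_simps)
    have "norm (z *\<^sub>R (\<i> * (cis t - 1))) \<le> \<bar>s\<bar> * norm z" for z :: real
      using mult_left_mono[OF order_trans[OF norm_cis_minus_1[of t] t], of "\<bar>z\<bar>"]
      by (simp add: norm_mult mult.commute)
    then show "onorm (\<lambda>z. z *\<^sub>R (\<i> * (cis t - 1))) \<le> \<bar>s\<bar>"
      by (rule onorm_le)
  qed auto
  then show ?thesis by (simp add: power2_eq_square algebra_simps)
qed

lemma borel_measurable_cis [measurable (raw)]:
  "f \<in> borel_measurable M \<Longrightarrow> (\<lambda>x. cis (f x)) \<in> borel_measurable M"
  by (rule borel_measurable_continuous_on[where f=cis]) (auto intro: continuous_intros)

lemma fourier_cis: "fourier \<phi> y = (\<integral>x. \<phi> x * cis (- 2 * pi * (x \<bullet> y)) \<partial>lborel)"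
  unfolding fourier_def by (simp add: cis_conv_exp mult_ac)

lemma integrable_mult_cis:
  assumes "integrable lborel (F :: 'a::euclidean_space \<Rightarrow> complex)" "e \<in> borel_measurable borel"
  shows "integrable lborel (\<lambda>x. F x * cis (e x))"
proof (rule Bochner_Integration.integrable_bound[OF assms(1)])
  have [measurable]: "F \<in> borel_measurable borel" "e \<in> borel_measurable borel" using assms by auto
  show "(\<lambda>x. F x * cis (e x)) \<in> borel_measurable lborel" by measurable
qed (simp add: norm_mult)

section \<open>Changes of variables and exchange of integrals with a phase\<close>

lemma lborel_integral_affine:
  fixes f :: "'a::euclidean_space \<Rightarrow> 'b::{banach, second_countable_topology}"
  assumes [measurable]: "f \<in> borel_measurable borel" and c: "c \<noteq> 0"
  shows "integral\<^sup>L lborel f = (\<bar>c\<bar> ^ DIM('a)) *\<^sub>R (\<integral>x. f (t + c *\<^sub>R x) \<partial>lborel)"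
  using c by (subst lborel_affine[OF c, of t]) (simp add: integral_density integral_distr)

lemma lborel_integrable_affine:
  fixes f :: "'a::euclidean_space \<Rightarrow> 'b::{banach, second_countable_topology}"
  assumes f: "integrable lborel f" and c: "c \<noteq> 0"
  shows "integrable lborel (\<lambda>x. f (t + c *\<^sub>R x))"
proof -
  have [measurable]: "f \<in> borel_measurable borel" using f by auto
  have "integrable (density (distr lborel borel (\<lambda>x. t + c *\<^sub>R x)) (\<lambda>_. ennreal (\<bar>c\<bar> ^ DIM('a)))) f"
    using f lborel_affine[OF c, of t] by simp
  then have "integrable lborel (\<lambda>x. (\<bar>c\<bar> ^ DIM('a)) *\<^sub>R f (t + c *\<^sub>R x))"
    by (subst (asm) integrable_density) (auto simp: integrable_distr_eq)
  from integrable_scaleR_right[of "inverse (\<bar>c\<bar> ^ DIM('a))", OF this] show ?thesis using c by simp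
qed

text \<open>The phase factor has modulus 1, so the integrand on the product space is dominated by
  the integrable product |F(x)| |G(y)| and Fubini applies for any measurable phase.\<close>

lemma integral_cis_swap:
  fixes F :: "'a::euclidean_space \<Rightarrow> complex" and G :: "'b::euclidean_space \<Rightarrow> complex"
  assumes F: "integrable lborel F" and G: "integrable lborel G"
    and e: "(\<lambda>(x, y). e x y) \<in> borel_measurable (lborel \<Otimes>\<^sub>M lborel)"
  shows "(\<integral>x. F x * (\<integral>y. G y * cis (e x y) \<partial>lborel) \<partial>lborel) =
    (\<integral>y. G y * (\<integral>x. F x * cis (e x y) \<partial>lborel) \<partial>lborel)"
proof -
  have [measurable]: "F \<in> borel_measurable borel" "G \<in> borel_measurable borel" using F G by auto
  have e1: "(\<lambda>y. e x y) \<in> borel_measurable borel" for x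
    using measurable_compose[OF measurable_Pair1'[of x lborel lborel] e] by (simp add: comp_def)
  have int: "integrable (lborel \<Otimes>\<^sub>M lborel) (\<lambda>(x, y). F x * (G y * cis (e x y)))"
  proof (rule lborel_pair.Fubini_integrable)
    have "(\<lambda>p. F (fst p) * (G (snd p) * cis (e (fst p) (snd p)))) \<in> borel_measurable (lborel \<Otimes>\<^sub>M lborel)"
      using e by (simp add: case_prod_beta')
    then show "(\<lambda>(x, y). F x * (G y * cis (e x y))) \<in> borel_measurable (lborel \<Otimes>\<^sub>M lborel)"
      by (simp add: case_prod_beta')
    show "integrable lborel (\<lambda>x. \<integral>y. norm (case (x, y) of (x, y) \<Rightarrow> F x * (G y * cis (e x y))) \<partial>lborel)"
      using F by (simp add: norm_mult)
    show "AE x in lborel. integrable lborel (\<lambda>y. case (x, y) of (x, y) \<Rightarrow> F x * (G y * cis (e x y)))"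
      using integrable_mult_cis[OF G e1] by simp
  qed
  have "(\<integral>x. F x * (\<integral>y. G y * cis (e x y) \<partial>lborel) \<partial>lborel) =
    (\<integral>x. (\<integral>y. F x * (G y * cis (e x y)) \<partial>lborel) \<partial>lborel)" by simp
  also have "\<dots> = (\<integral>y. (\<integral>x. F x * (G y * cis (e x y)) \<partial>lborel) \<partial>lborel)"
    by (rule lborel_pair.Fubini_integral[OF int, symmetric])
  also have "\<dots> = (\<integral>y. (\<integral>x. G y * (F x * cis (e x y)) \<partial>lborel) \<partial>lborel)"
    by (simp add: mult_ac)
  finally show ?thesis by simp
qed

lemma fourier_translate:
  assumes [measurable]: "\<phi> \<in> borel_measurable borel"
  shows "(\<integral>u. \<phi> (u + v) * cis (- 2 * pi * (u \<bullet> y)) \<partial>lborel) = cis (2 * pi * (v \<bullet> y)) * fourier \<phi> y"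
proof -
  have "cis (2 * pi * (v \<bullet> y)) * fourier \<phi> y =
    (\<integral>x. \<phi> x * (cis (2 * pi * (v \<bullet> y)) * cis (- 2 * pi * (x \<bullet> y))) \<partial>lborel)"
    unfolding fourier_cis by (subst integral_mult_right_zero[symmetric]) (simp only: mult_ac)
  also have "\<dots> = (\<integral>x. \<phi> (v + 1 *\<^sub>R x) * (cis (2 * pi * (v \<bullet> y)) * cis (- 2 * pi * ((v + 1 *\<^sub>R x) \<bullet> y))) \<partial>lborel)"
    by (subst lborel_integral_affine[of _ 1 v]) auto
  also have "\<dots> = (\<integral>u. \<phi> (u + v) * cis (- 2 * pi * (u \<bullet> y)) \<partial>lborel)"
    by (rule Bochner_Integration.integral_cong) (auto simp: cis_mult inner_add_left algebra_simps)
  finally show ?thesis ..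
qed

text \<open>Adding z to y multiplies the integrand at u by cis s with s = -2 pi (u \<bullet> z). The
  remainder is therefore \<phi>(u) (cis s - 1 - \<i> s) up to a unimodular factor, and its bound s^2
  |\<phi>(u)| is dominated by |z|^2 times the integrand of a second moment.\<close>

lemma fourier_has_derivative:
  assumes "rapid \<phi>"
  shows "(fourier \<phi> has_derivative
    (\<lambda>z. \<Sum>b\<in>Basis. (z \<bullet> b) *\<^sub>R fourier (\<lambda>u. - 2 * pi * \<i> * of_real (u \<bullet> b) * \<phi> u) y)) (at y)"
  unfolding fourier_cis
proof (rule has_derivative_integral[where B="\<lambda>u. (2 * pi)\<^sup>2 * ((1 + norm u) ^ 2 * norm (\<phi> u))"])
  show "integrable lborel (\<lambda>u. \<phi> u * cis (- 2 * pi * (u \<bullet> y)))" for y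
    by (intro integrable_mult_cis rapid_integrable assms) auto
  show "integrable lborel (\<lambda>u. - 2 * pi * \<i> * of_real (u \<bullet> b) * \<phi> u * cis (- 2 * pi * (u \<bullet> y)))" for b
    by (intro integrable_mult_cis rapid_integrable rapid_mult_linear assms) auto
  show "integrable lborel (\<lambda>u. (2 * pi)\<^sup>2 * ((1 + norm u) ^ 2 * norm (\<phi> u)))"
    by (intro integrable_mult_right rapid_moment assms)
  fix z u :: 'a
  define s where "s = - 2 * pi * (u \<bullet> z)"
  have "(\<Sum>b\<in>Basis. (z \<bullet> b) *\<^sub>R (- 2 * pi * \<i> * of_real (u \<bullet> b) * \<phi> u * cis (- 2 * pi * (u \<bullet> y)))) =
    (\<Sum>b\<in>Basis. of_real ((u \<bullet> b) * (z \<bullet> b)) * (- 2 * pi * \<i> * \<phi> u * cis (- 2 * pi * (u \<bullet> y))))"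
    by (intro sum.cong) (auto simp: scaleR_conv_of_real mult_ac)
  also have "\<dots> = of_real (u \<bullet> z) * (- 2 * pi * \<i> * \<phi> u * cis (- 2 * pi * (u \<bullet> y)))"
    by (subst sum_distrib_right[symmetric]) (simp only: of_real_sum[symmetric] euclidean_inner[of u z])
  also have "\<dots> = \<phi> u * cis (- 2 * pi * (u \<bullet> y)) * (\<i> * of_real s)"
    by (simp add: s_def)
  finally have S: "(\<Sum>b\<in>Basis. (z \<bullet> b) *\<^sub>R (- 2 * pi * \<i> * of_real (u \<bullet> b) * \<phi> u * cis (- 2 * pi * (u \<bullet> y)))) = \<dots>" .
  have cis_add: "cis (- 2 * pi * (u \<bullet> (y + z))) = cis (- 2 * pi * (u \<bullet> y)) * cis s"
    by (simp add: s_def cis_mult inner_add_right distrib_left)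
  have "\<phi> u * cis (- 2 * pi * (u \<bullet> (y + z))) - \<phi> u * cis (- 2 * pi * (u \<bullet> y)) -
     (\<Sum>b\<in>Basis. (z \<bullet> b) *\<^sub>R (- 2 * pi * \<i> * of_real (u \<bullet> b) * \<phi> u * cis (- 2 * pi * (u \<bullet> y)))) =
     \<phi> u * cis (- 2 * pi * (u \<bullet> y)) * (cis s - 1 - \<i> * of_real s)"
    unfolding S cis_add by (simp only: right_diff_distrib mult.assoc mult_1_right)
  also have "norm \<dots> \<le> norm (\<phi> u) * s\<^sup>2"
    using mult_left_mono[OF norm_cis_taylor[of s], of "norm (\<phi> u)"] by (simp add: norm_mult)
  also have "\<dots> \<le> norm (\<phi> u) * (2 * pi * ((1 + norm u) * norm z))\<^sup>2"
  proof (rule mult_left_mono, rule power2_le_iff_abs_le[THEN iffD2])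
    have "\<bar>u \<bullet> z\<bar> \<le> norm u * norm z" by (rule Cauchy_Schwarz_ineq2)
    also have "\<dots> \<le> (1 + norm u) * norm z" by (intro mult_right_mono) auto
    finally show "\<bar>s\<bar> \<le> 2 * pi * ((1 + norm u) * norm z)" by (simp add: s_def abs_mult mult_left_mono)
  qed simp_all
  also have "\<dots> = (norm z)\<^sup>2 * ((2 * pi)\<^sup>2 * ((1 + norm u) ^ 2 * norm (\<phi> u)))"
    by (simp only: power_mult_distrib mult_ac)
  finally show "norm (\<phi> u * cis (- 2 * pi * (u \<bullet> (y + z))) - \<phi> u * cis (- 2 * pi * (u \<bullet> y)) -
     (\<Sum>b\<in>Basis. (z \<bullet> b) *\<^sub>R (- 2 * pi * \<i> * of_real (u \<bullet> b) * \<phi> u * cis (- 2 * pi * (u \<bullet> y)))))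
     \<le> (norm z)\<^sup>2 * ((2 * pi)\<^sup>2 * ((1 + norm u) ^ 2 * norm (\<phi> u)))" .
qed

text \<open>Each partial derivative is again the transform of a rapidly decreasing function, namely
  of a coordinate multiple.\<close>

lemma smooth_fourier:
  assumes "rapid \<phi>" shows "smooth (fourier \<phi>)"
proof (rule smooth_coinduct[of _ "fourier ` Collect rapid"])
  fix \<eta> :: "'a \<Rightarrow> complex" and b y :: 'a
  assume "\<eta> \<in> fourier ` Collect rapid"
  then obtain \<phi> where \<phi>: "rapid \<phi>" "\<eta> = fourier \<phi>" by auto
  note D = fourier_has_derivative[OF \<phi>(1)]
  show "\<eta> differentiable (at y)" using D \<phi>(2) by (auto intro: differentiableI)
  assume b: "b \<in> Basis"
  have "partial b \<eta> = fourier (\<lambda>u. - 2 * pi * \<i> * of_real (u \<bullet> b) * \<phi> u)"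
  proof
    fix y
    show "partial b \<eta> y = fourier (\<lambda>u. - 2 * pi * \<i> * of_real (u \<bullet> b) * \<phi> u) y"
      unfolding \<phi>(2) partial_eqI[OF D] using b
      by (simp add: inner_Basis if_distrib[of "\<lambda>r. r *\<^sub>R _"] sum.delta cong: if_cong)
  qed
  then show "partial b \<eta> \<in> fourier ` Collect rapid"
    using rapid_mult_linear[OF \<phi>(1), of "- 2 * pi * \<i>" b] by blast
qed (use assms in auto)

text \<open>Comparing derivatives at \<open>v = 0\<close> in \<open>fourier_translate\<close> replaces integration by parts.\<close>

lemma fourier_partial:
  assumes "\<phi> \<in> schwartz" "b \<in> Basis"
  shows "fourier (partial b \<phi>) y = 2 * pi * \<i> * of_real (b \<bullet> y) * fourier \<phi> y"
proof -
  let ?e = "\<lambda>u. cis (- 2 * pi * (u \<bullet> y))"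
  have [measurable]: "\<phi> \<in> borel_measurable borel"
    using assms(1) by (intro rapid_measurable schwartz_rapid)
  \<comment> \<open>The exponent \<open>DIM('a) + 2\<close> makes the remainder integrable in u; for
    |z| at most 1 the factor (1 + |z|)^k is absorbed into 2^k.\<close>
  obtain C where C: "C \<ge> 0" "\<And>x z. norm (\<phi> (x + z) - \<phi> x - (\<Sum>b\<in>Basis. (z \<bullet> b) *\<^sub>R partial b \<phi> x)) \<le>
       C * ((norm z)\<^sup>2 * (1 + norm z) ^ (DIM('a) + 2) / (1 + norm x) ^ (DIM('a) + 2))"
    using schwartz_taylor[OF assms(1), of "DIM('a) + 2"] by blast
  have "((\<lambda>v. \<integral>u. \<phi> (u + v) * ?e u \<partial>lborel) has_derivative
    (\<lambda>z. \<Sum>b\<in>Basis. (z \<bullet> b) *\<^sub>R (\<integral>u. partial b \<phi> u * ?e u \<partial>lborel))) (at 0)"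
  proof (rule has_derivative_integral[where B="\<lambda>u. C * 2 ^ (DIM('a) + 2) * (1 / (1 + norm u) ^ (DIM('a) + 2))"])
    show "integrable lborel (\<lambda>u. \<phi> (u + v) * ?e u)" for v
      using lborel_integrable_affine[OF rapid_integrable[OF schwartz_rapid[OF assms(1)]], of 1 v]
      by (intro integrable_mult_cis) (auto simp: add.commute)
    show "integrable lborel (\<lambda>u. partial b \<phi> u * ?e u)" if "b \<in> Basis" for b
      by (intro integrable_mult_cis rapid_integrable schwartz_rapid schwartz_partial assms that) auto
    show "integrable lborel (\<lambda>u::'a. C * 2 ^ (DIM('a) + 2) * (1 / (1 + norm u) ^ (DIM('a) + 2)))"
      by (intro integrable_mult_right integrable_weight_lborel)
    fix z u :: 'a assume z: "norm z \<le> 1"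
    have "\<phi> (u + (0 + z)) * ?e u - \<phi> (u + 0) * ?e u - (\<Sum>b\<in>Basis. (z \<bullet> b) *\<^sub>R (partial b \<phi> u * ?e u)) =
      (\<phi> (u + z) - \<phi> u - (\<Sum>b\<in>Basis. (z \<bullet> b) *\<^sub>R partial b \<phi> u)) * ?e u"
      by (simp add: algebra_simps sum_distrib_left)
    also have "norm \<dots> \<le> C * ((norm z)\<^sup>2 * (1 + norm z) ^ (DIM('a) + 2) / (1 + norm u) ^ (DIM('a) + 2))"
      using C(2)[of u z] by (simp add: norm_mult)
    also have "\<dots> \<le> C * ((norm z)\<^sup>2 * 2 ^ (DIM('a) + 2) / (1 + norm u) ^ (DIM('a) + 2))"
      using z C(1) by (intro mult_left_mono divide_right_mono power_mono) auto
    finally show "norm (\<phi> (u + (0 + z)) * ?e u - \<phi> (u + 0) * ?e u - (\<Sum>b\<in>Basis. (z \<bullet> b) *\<^sub>R (partial b \<phi> u * ?e u)))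
      \<le> (norm z)\<^sup>2 * (C * 2 ^ (DIM('a) + 2) * (1 / (1 + norm u) ^ (DIM('a) + 2)))"
      by (simp add: mult_ac)
  qed
  then have 1: "((\<lambda>v. cis (2 * pi * (v \<bullet> y)) * fourier \<phi> y) has_derivative
    (\<lambda>z. \<Sum>b\<in>Basis. (z \<bullet> b) *\<^sub>R fourier (partial b \<phi>) y)) (at 0)"
    unfolding fourier_translate[OF \<open>\<phi> \<in> borel_measurable borel\<close>] fourier_cis[symmetric] .
  have 2: "((\<lambda>v. cis (2 * pi * (v \<bullet> y)) * fourier \<phi> y) has_derivative
    (\<lambda>z. 2 * pi * \<i> * of_real (z \<bullet> y) * fourier \<phi> y)) (at 0)"
    by (auto intro!: derivative_eq_intros simp: scaleR_conv_of_real)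
  have "(\<Sum>b'\<in>Basis. (b \<bullet> b') *\<^sub>R fourier (partial b' \<phi>) y) = 2 * pi * \<i> * of_real (b \<bullet> y) * fourier \<phi> y"
    using has_derivative_unique[OF 1 2] by meson
  then show ?thesis using assms(2)
    by (simp add: inner_Basis if_distrib[of "\<lambda>r. r *\<^sub>R _"] sum.delta cong: if_cong)
qed

lemma norm_fourier_le: "norm (fourier \<phi> y) \<le> (\<integral>x. norm (\<phi> x) \<partial>lborel)"
  unfolding fourier_cis by (rule order_trans[OF integral_norm_bound]) (simp add: norm_mult)

text \<open>Induction on the power of the weight, for all Schwartz functions at once: |y| is at most
  the sum of the |y \<bullet> b|, and each |y \<bullet> b| times the transform is controlled by the
  transform of a partial derivative. The factor 2 pi is at least 1 and is dropped.\<close>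

lemma fourier_rapid:
  assumes "\<phi> \<in> schwartz" shows "rapid (fourier \<phi>)"
  unfolding rapid_def
proof (intro conjI allI)
  show "fourier \<phi> \<in> borel_measurable borel"
    by (intro borel_measurable_continuous_onI smooth_continuous_on smooth_fourier schwartz_rapid assms)
  show "\<exists>C. \<forall>y. (1 + norm y) ^ k * norm (fourier \<phi> y) \<le> C" for k
    using assms
  proof (induction k arbitrary: \<phi>)
    case 0
    then show ?case using norm_fourier_le[of \<phi>] by auto
  next
    case (Suc k)
    obtain C where C: "\<And>y. (1 + norm y) ^ k * norm (fourier \<phi> y) \<le> C"
      using Suc by blast
    have "\<forall>b\<in>Basis. \<exists>C. \<forall>y. (1 + norm y) ^ k * norm (fourier (partial b \<phi>) y) \<le> C"
      using Suc schwartz_partial by blast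
    from bchoice[OF this] obtain D where
      D: "\<And>b y. b \<in> Basis \<Longrightarrow> (1 + norm y) ^ k * norm (fourier (partial b \<phi>) y) \<le> D b"
      by blast
    have "(1 + norm y) ^ Suc k * norm (fourier \<phi> y) \<le> C + (\<Sum>b\<in>Basis. D b)" for y
    proof -
      let ?w = "(1 + norm y) ^ k"
      have b: "?w * (\<bar>y \<bullet> b\<bar> * norm (fourier \<phi> y)) \<le> D b" if "b \<in> Basis" for b
      proof -
        have "1 * (\<bar>y \<bullet> b\<bar> * norm (fourier \<phi> y)) \<le> 2 * pi * (\<bar>y \<bullet> b\<bar> * norm (fourier \<phi> y))"
          using pi_ge_two by (intro mult_right_mono) auto
        also have "\<dots> = norm (fourier (partial b \<phi>) y)"
          using fourier_partial[OF Suc.prems that, of y] by (simp add: norm_mult inner_commute)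
        finally have "?w * (\<bar>y \<bullet> b\<bar> * norm (fourier \<phi> y)) \<le> ?w * norm (fourier (partial b \<phi>) y)"
          by (intro mult_left_mono) auto
        then show ?thesis using D[OF that, of y] by linarith
      qed
      have "(1 + norm y) ^ Suc k * norm (fourier \<phi> y) = ?w * norm (fourier \<phi> y) + norm y * (?w * norm (fourier \<phi> y))"
        by (simp add: algebra_simps)
      also have "\<dots> \<le> C + (\<Sum>b\<in>Basis. \<bar>y \<bullet> b\<bar>) * (?w * norm (fourier \<phi> y))"
        by (intro add_mono C mult_right_mono norm_le_l1) auto
      also have "\<dots> = C + (\<Sum>b\<in>Basis. ?w * (\<bar>y \<bullet> b\<bar> * norm (fourier \<phi> y)))"
        by (simp add: sum_distrib_left sum_distrib_right mult_ac)
      also have "\<dots> \<le> C + (\<Sum>b\<in>Basis. D b)"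
        by (intro add_left_mono sum_mono b)
      finally show ?thesis .
    qed
    then show ?case by blast
  qed
qed

section \<open>A cutoff whose transform has nonzero integral\<close>

lemma integral_continuous_pos:
  fixes g :: "'a::euclidean_space \<Rightarrow> real"
  assumes cont: "continuous_on UNIV g" and nonneg: "\<And>x. 0 \<le> g x" and "g x0 \<noteq> 0" and int: "integrable lborel g"
  shows "(\<integral>x. g x \<partial>lborel) \<noteq> 0"
proof
  assume "(\<integral>x. g x \<partial>lborel) = 0"
  then have "AE x in lborel. g x = 0"
    using integral_nonneg_eq_0_iff_AE[OF int] nonneg by simp
  moreover have op: "open {x. g x \<noteq> 0}"
    by (intro open_Collect_neq cont continuous_on_const)
  ultimately have "emeasure lborel {x. g x \<noteq> 0} = 0"
    by (subst (asm) AE_iff_measurable[of "{x. g x \<noteq> 0}"]) auto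
  then have "negligible {x. g x \<noteq> 0}"
    using op by (simp add: negligible_iff_null_sets null_sets_def)
  then show False using open_not_negligible[OF op] \<open>g x0 \<noteq> 0\<close> by blast
qed

text \<open>If \<open>\<integral> fourier h\<close> vanished for all translates of a bump, then \<open>fourier h\<close> would be orthogonal
  to itself. The constant \<open>\<integral> fourier h\<close> thus need not be identified as \<open>h 0\<close>,
  and Fourier inversion is not needed.\<close>

lemma ex_cutoff:
  obtains h :: "'a::euclidean_space \<Rightarrow> complex"
  where "smooth h" "compact (closure {x. h x \<noteq> 0})" "(\<integral>x. fourier h x \<partial>lborel) \<noteq> 0"
proof -
  obtain h0 :: "'a \<Rightarrow> real" where h0: "smooth (\<lambda>x. complex_of_real (h0 x))" "\<And>x. 0 \<le> h0 x" "0 < h0 0"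
    "\<And>x. 1 \<le> norm x \<Longrightarrow> h0 x = 0"
    using ex_smooth_bump by blast
  define h where "h x = complex_of_real (h0 x)" for x
  have sm: "smooth h" using h0(1) by (simp add: h_def[abs_def])
  have supp: "compact (closure {x. h (1 *\<^sub>R x + v) \<noteq> 0})" for v
  proof -
    have "{x. h (1 *\<^sub>R x + v) \<noteq> 0} \<subseteq> ball (- v) 1"
      using h0(4) by (force simp: h_def dist_norm norm_minus_commute algebra_simps)
    then show ?thesis using bounded_subset bounded_ball by (auto simp: compact_closure)
  qed
  have hS: "h \<in> schwartz" using compact_support_schwartz[OF sm] supp[of 0] by simp
  note hr = schwartz_rapid[OF hS] and fr = fourier_rapid[OF hS]
  have "\<exists>v. (\<integral>x. fourier (\<lambda>x. h (1 *\<^sub>R x + v)) x \<partial>lborel) \<noteq> 0"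
  proof (rule ccontr)
    assume "\<nexists>v. (\<integral>x. fourier (\<lambda>x. h (1 *\<^sub>R x + v)) x \<partial>lborel) \<noteq> 0"
    then have "(\<integral>x. fourier (\<lambda>x. h (1 *\<^sub>R x + v)) x \<partial>lborel) = 0" for v by blast
    moreover have "fourier (\<lambda>x. h (1 *\<^sub>R x + v)) x = fourier h x * cis (2 * pi * (v \<bullet> x))" for v x
      using fourier_translate[OF rapid_measurable[OF hr], of v x] by (simp add: fourier_cis)
    \<comment> \<open>Translating \<open>h\<close> by v multiplies its transform by a character, so
      the vanishing integrals can be weighted with h(v) and integrated over v. After the exchange of
      integrals, the inner one is the conjugate of \<open>fourier h\<close>, because
      \<open>h\<close> is real.\<close>
    ultimately have "(\<integral>v. h v * (\<integral>x. fourier h x * cis (2 * pi * (v \<bullet> x)) \<partial>lborel) \<partial>lborel) = 0" by simp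
    also have "(\<integral>v. h v * (\<integral>x. fourier h x * cis (2 * pi * (v \<bullet> x)) \<partial>lborel) \<partial>lborel) =
        (\<integral>x. fourier h x * (\<integral>v. h v * cis (2 * pi * (v \<bullet> x)) \<partial>lborel) \<partial>lborel)"
      by (rule integral_cis_swap) (auto intro: rapid_integrable hr fr)
    also have "(\<lambda>x. \<integral>v. h v * cis (2 * pi * (v \<bullet> x)) \<partial>lborel) = (\<lambda>x. cnj (fourier h x))"
    proof
      fix x
      have "(\<lambda>v. h v * cis (2 * pi * (v \<bullet> x))) = (\<lambda>v. cnj (h v * cis (- 2 * pi * (v \<bullet> x))))"
        by (simp add: fun_eq_iff h_def cis_cnj)
      then show "(\<integral>v. h v * cis (2 * pi * (v \<bullet> x)) \<partial>lborel) = cnj (fourier h x)"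
        unfolding fourier_cis by (simp only: Bochner_Integration.integral_cnj)
    qed
    also have "(\<integral>x. fourier h x * cnj (fourier h x) \<partial>lborel) = (\<integral>x. complex_of_real ((cmod (fourier h x))\<^sup>2) \<partial>lborel)"
      by (simp only: complex_norm_square)
    also have "\<dots> = complex_of_real (\<integral>x. (cmod (fourier h x))\<^sup>2 \<partial>lborel)"
      by (rule integral_complex_of_real)
    finally have "(\<integral>x. (cmod (fourier h x))\<^sup>2 \<partial>lborel) = 0" by simp
    moreover have "(\<integral>x. (cmod (fourier h x))\<^sup>2 \<partial>lborel) \<noteq> 0"
    proof (rule integral_continuous_pos[of _ 0])
      show "continuous_on UNIV (\<lambda>x. (cmod (fourier h x))\<^sup>2)"
        by (intro continuous_intros smooth_continuous_on smooth_fourier hr)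
      obtain C where C: "\<And>x. (1 + norm x) ^ 0 * norm (fourier h x) \<le> C"
        using fr unfolding rapid_def by blast
      show "integrable lborel (\<lambda>x. (cmod (fourier h x))\<^sup>2)"
      proof (rule Bochner_Integration.integrable_bound)
        show "integrable lborel (\<lambda>x. C * cmod (fourier h x))"
          by (intro integrable_mult_right integrable_norm rapid_integrable fr)
        show "(\<lambda>x. (cmod (fourier h x))\<^sup>2) \<in> borel_measurable lborel"
          using rapid_measurable[OF fr] by simp
        have "norm ((cmod (fourier h x))\<^sup>2) \<le> norm (C * cmod (fourier h x))" for x
          using C[of x] by (simp add: power2_eq_square abs_mult mult_right_mono)
        then show "AE x in lborel. norm ((cmod (fourier h x))\<^sup>2) \<le> norm (C * cmod (fourier h x))" by simp
      qed
      \<comment> \<open>The witness for a nonzero value is the origin, where the transform is the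
        integral of the bump and hence nonzero.\<close>
      have "integrable lborel h0"
        using rapid_integrable[OF hr] complex_of_real_integrable_eq[of lborel h0] by (simp add: h_def[abs_def])
      moreover have "continuous_on UNIV h0"
        using smooth_continuous_on[OF sm, of UNIV] continuous_on_Re[of UNIV h] by (simp add: h_def[abs_def])
      ultimately have "(\<integral>x. h0 x \<partial>lborel) \<noteq> 0"
        using integral_continuous_pos[of h0 0] h0 by auto
      then show "(cmod (fourier h 0))\<^sup>2 \<noteq> 0"
        by (simp add: fourier_cis h_def)
    qed simp
    ultimately show False by contradiction
  qed
  then obtain v where "(\<integral>x. fourier (\<lambda>x. h (1 *\<^sub>R x + v)) x \<partial>lborel) \<noteq> 0" by blast
  then show ?thesis
    using that[of "\<lambda>x. h (1 *\<^sub>R x + v)"] smooth_affine[OF sm, of 1 v] supp[of v] by simp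
qed

section \<open>Approximate identities\<close>

lemma iter_partial_diff:
  assumes "smooth \<phi>" "smooth \<psi>" "set bs \<subseteq> Basis"
  shows "iter_partial bs (\<lambda>x. \<phi> x - \<psi> x) = (\<lambda>x. iter_partial bs \<phi> x - iter_partial bs \<psi> x)"
  using iter_partial_lincomb[OF assms, of 1] by simp

lemma schwartz_lincomb:
  assumes "\<phi> \<in> schwartz" "\<psi> \<in> schwartz"
  shows "(\<lambda>x. \<phi> x - c * \<psi> x) \<in> schwartz"
proof (rule schwartzI)
  note sm = assms[THEN schwartz_smooth]
  show "smooth (\<lambda>x. \<phi> x - c * \<psi> x)" by (intro smooth_lincomb sm)
  fix k and bs :: "'a list" assume bs: "set bs \<subseteq> Basis"
  obtain C where C: "\<And>x. (1 + norm x) ^ k * norm (iter_partial bs \<phi> x) \<le> C"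
    using schwartz_decay[OF assms(1) bs] by blast
  obtain D where D: "\<And>x. (1 + norm x) ^ k * norm (iter_partial bs \<psi> x) \<le> D"
    using schwartz_decay[OF assms(2) bs] by blast
  have "(1 + norm x) ^ k * norm (iter_partial bs \<phi> x - c * iter_partial bs \<psi> x) \<le> C + norm c * D" for x
  proof -
    have "(1 + norm x) ^ k * norm (iter_partial bs \<phi> x - c * iter_partial bs \<psi> x) \<le>
      (1 + norm x) ^ k * (norm (iter_partial bs \<phi> x) + norm c * norm (iter_partial bs \<psi> x))"
      by (intro mult_left_mono order_trans[OF norm_triangle_ineq4]) (auto simp: norm_mult)
    also have "\<dots> = (1 + norm x) ^ k * norm (iter_partial bs \<phi> x) +
        norm c * ((1 + norm x) ^ k * norm (iter_partial bs \<psi> x))"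
      by (simp add: algebra_simps)
    also have "\<dots> \<le> C + norm c * D" by (intro add_mono mult_left_mono C D) auto
    finally show ?thesis .
  qed
  then show "\<exists>C. \<forall>x. (1 + norm x) ^ k * norm (iter_partial bs (\<lambda>x. \<phi> x - c * \<psi> x) x) \<le> C"
    unfolding iter_partial_lincomb[OF sm bs] by blast
qed

lemma schwartz_diff: "\<phi> \<in> schwartz \<Longrightarrow> \<psi> \<in> schwartz \<Longrightarrow> (\<lambda>x. \<phi> x - \<psi> x) \<in> schwartz"
  using schwartz_lincomb[of \<phi> \<psi> 1] by simp

lemma schwartz_scale: "\<phi> \<in> schwartz \<Longrightarrow> (\<lambda>x. c * \<phi> x) \<in> schwartz"
  using schwartz_lincomb[of \<phi> \<phi> "1 - c"] by (simp add: algebra_simps)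

lemma schwartz_seminorm_le:
  "(\<And>x. (1 + norm x) ^ k * norm (iter_partial bs \<phi> x) \<le> C) \<Longrightarrow> schwartz_seminorm k bs \<phi> \<le> C"
  unfolding schwartz_seminorm_def by (rule cSUP_least) auto

lemma le_schwartz_seminorm:
  "\<phi> \<in> schwartz \<Longrightarrow> set bs \<subseteq> Basis \<Longrightarrow>
    (1 + norm x) ^ k * norm (iter_partial bs \<phi> x) \<le> schwartz_seminorm k bs \<phi>"
  unfolding schwartz_seminorm_def by (rule cSUP_upper) (auto simp: schwartz_def)

lemma schwartz_seminorm_triangle:
  assumes "\<phi> \<in> schwartz" "\<psi> \<in> schwartz" "\<theta> \<in> schwartz" "set bs \<subseteq> Basis"
  shows "schwartz_seminorm k bs (\<lambda>x. \<phi> x - \<theta> x) \<le>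
    schwartz_seminorm k bs (\<lambda>x. \<phi> x - \<psi> x) + schwartz_seminorm k bs (\<lambda>x. \<psi> x - \<theta> x)"
proof (rule schwartz_seminorm_le)
  fix x :: 'a
  note sm = assms(1-3)[THEN schwartz_smooth]
  have "(1 + norm x) ^ k * norm (iter_partial bs (\<lambda>x. \<phi> x - \<theta> x) x) \<le>
    (1 + norm x) ^ k * norm (iter_partial bs (\<lambda>x. \<phi> x - \<psi> x) x) +
    (1 + norm x) ^ k * norm (iter_partial bs (\<lambda>x. \<psi> x - \<theta> x) x)"
    unfolding distrib_left[symmetric]
    using norm_triangle_ineq[of "iter_partial bs \<phi> x - iter_partial bs \<psi> x" "iter_partial bs \<psi> x - iter_partial bs \<theta> x"]
    by (intro mult_left_mono) (simp_all add: iter_partial_diff sm assms(4))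
  also have "\<dots> \<le> schwartz_seminorm k bs (\<lambda>x. \<phi> x - \<psi> x) + schwartz_seminorm k bs (\<lambda>x. \<psi> x - \<theta> x)"
    by (intro add_mono le_schwartz_seminorm schwartz_diff assms)
  finally show "(1 + norm x) ^ k * norm (iter_partial bs (\<lambda>x. \<phi> x - \<theta> x) x) \<le> \<dots>" .
qed

text \<open>Continuity is given for the topology generated by seminorm balls with arbitrary centres.
  Induction over the generation of an open set reduces convergence to one such ball, and the
  triangle inequality handles a centre other than the limit.\<close>

lemma tempered_distribution_tendsto:
  fixes f :: "('a::euclidean_space \<Rightarrow> complex) \<Rightarrow> complex"
  assumes f: "tempered_distribution f" and \<phi>: "\<And>n. \<phi> n \<in> schwartz" and \<psi>: "\<psi> \<in> schwartz"
    and lim: "\<And>k bs. set bs \<subseteq> Basis \<Longrightarrow> (\<lambda>n. schwartz_seminorm k bs (\<lambda>x. \<phi> n x - \<psi> x)) \<longlonglongrightarrow> 0"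
  shows "(\<lambda>n. f (\<phi> n)) \<longlonglongrightarrow> f \<psi>"
proof -
  define \<B> :: "('a \<Rightarrow> complex) set set" where "\<B> = {{\<psi> \<in> schwartz. schwartz_seminorm k bs (\<lambda>x. \<psi> x - \<phi> x) < \<epsilon>} | \<phi> k bs \<epsilon>.
        \<phi> \<in> schwartz \<and> set bs \<subseteq> Basis \<and> \<epsilon> > 0}"
  have top: "schwartz_topology = topology_generated_by \<B>"
    unfolding schwartz_topology_def \<B>_def ..
  have "limitin schwartz_topology \<phi> \<psi> sequentially"
    unfolding limitin_def top
  proof (intro conjI allI impI)
    \<comment> \<open>A limit has to lie in the underlying space, which is the union of the
      generating sets; a unit ball around \<psi> is one that contains it.\<close>
    have "iter_partial [] (\<lambda>x. \<psi> x - \<psi> x) = (\<lambda>x. 0)" by simp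
    then have "schwartz_seminorm 0 [] (\<lambda>x. \<psi> x - \<psi> x) \<le> 0"
      by (intro schwartz_seminorm_le) simp
    then have "\<psi> \<in> {\<eta> \<in> schwartz. schwartz_seminorm 0 [] (\<lambda>x. \<eta> x - \<psi> x) < 1}"
      using \<psi> by simp
    moreover have "{\<eta> \<in> schwartz. schwartz_seminorm 0 [] (\<lambda>x. \<eta> x - \<psi> x) < 1} \<in> \<B>"
      unfolding \<B>_def using \<psi> by (intro CollectI exI[of _ \<psi>] exI[of _ 0] exI[of _ "[]"] exI[of _ 1]) simp
    ultimately show "\<psi> \<in> topspace (topology_generated_by \<B>)"
      unfolding topology_generated_by_topspace by blast
  next
    fix U assume "openin (topology_generated_by \<B>) U \<and> \<psi> \<in> U"
    then have "generate_topology_on \<B> U" "\<psi> \<in> U" by (auto dest: openin_topology_generated_by)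
    then show "\<forall>\<^sub>F n in sequentially. \<phi> n \<in> U"
    proof (induction rule: generate_topology_on.induct)
      case (Int a b)
      then show ?case by (auto intro: eventually_conj)
    next
      case (UN K)
      then obtain k where k: "k \<in> K" "\<psi> \<in> k" by blast
      show ?case
        by (rule eventually_mono[OF UN.IH[OF \<open>k \<in> K\<close> \<open>\<psi> \<in> k\<close>]]) (use \<open>k \<in> K\<close> in blast)
    next
      case (Basis s)
      then obtain \<theta> k bs \<epsilon> where s: "s = {\<psi> \<in> schwartz. schwartz_seminorm k bs (\<lambda>x. \<psi> x - \<theta> x) < \<epsilon>}"
        and \<theta>: "\<theta> \<in> schwartz" "set bs \<subseteq> Basis" unfolding \<B>_def by blast
      \<comment> \<open>The room left between \<psi> and the boundary of the ball centred at
        \<theta>.\<close>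
      let ?d = "\<epsilon> - schwartz_seminorm k bs (\<lambda>x. \<psi> x - \<theta> x)"
      have "?d > 0" using Basis s by simp
      then have "\<forall>\<^sub>F n in sequentially. schwartz_seminorm k bs (\<lambda>x. \<phi> n x - \<psi> x) < ?d"
        using order_tendstoD(2)[OF lim[OF \<theta>(2)]] by blast
      then show ?case
      proof eventually_elim
        case (elim n)
        then show ?case
          using schwartz_seminorm_triangle[OF \<phi>[of n] \<psi> \<theta>, of k] s \<phi>[of n] by simp
      qed
    qed simp
  qed
  then have "limitin euclidean (f \<circ> \<phi>) (f \<psi>) sequentially"
    by (rule continuous_map_limit[rotated]) (use f in \<open>simp add: tempered_distribution_def\<close>)
  then show ?thesis by (simp add: comp_def)
qed

text \<open>For s > 0 this is the convolution of \<omega> with the rescaled kernel s^(-d) H(x/s).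
  The scale sits in the argument of \<omega>, so the kernel and its moments stay fixed as s tends to
  0.\<close>

definition convolve :: "('a::euclidean_space \<Rightarrow> complex) \<Rightarrow> ('a \<Rightarrow> complex) \<Rightarrow> real \<Rightarrow> 'a \<Rightarrow> complex" where
  "convolve \<omega> H s x = (\<integral>v. \<omega> (x - s *\<^sub>R v) * H v \<partial>lborel)"

lemma integrable_convolve:
  assumes "\<omega> \<in> schwartz" "integrable lborel H"
  shows "integrable lborel (\<lambda>v. \<omega> (x - s *\<^sub>R v) * H v)"
proof -
  have [measurable]: "\<omega> \<in> borel_measurable borel" "H \<in> borel_measurable borel"
    using assms rapid_measurable[OF schwartz_rapid] by auto
  obtain C where C: "\<And>x. (1 + norm x) ^ 0 * norm (iter_partial [] \<omega> x) \<le> C"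
    using schwartz_decay[OF assms(1), of "[]" 0] by auto
  show ?thesis
  proof (rule Bochner_Integration.integrable_bound)
    show "integrable lborel (\<lambda>v. C * norm (H v))" by (intro integrable_mult_right integrable_norm assms)
    have "norm (\<omega> (x - s *\<^sub>R v) * H v) \<le> norm (C * norm (H v))" for v
      using C[of "x - s *\<^sub>R v"] by (auto simp: norm_mult abs_mult intro!: mult_right_mono)
    then show "AE v in lborel. norm (\<omega> (x - s *\<^sub>R v) * H v) \<le> norm (C * norm (H v))" by simp
  qed simp
qed

text \<open>The Taylor bound is taken with weight exponent 0: it is then uniform in the base point x
  - s v, and integrability in v comes from \<open>H\<close>.\<close>

lemma convolve_has_derivative:
  assumes "\<omega> \<in> schwartz" "integrable lborel H"
  shows "(convolve \<omega> H s has_derivative (\<lambda>z. \<Sum>b\<in>Basis. (z \<bullet> b) *\<^sub>R convolve (partial b \<omega>) H s x)) (at x)"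
proof -
  obtain C where "C \<ge> 0" and C: "\<And>x z. norm (\<omega> (x + z) - \<omega> x - (\<Sum>b\<in>Basis. (z \<bullet> b) *\<^sub>R partial b \<omega> x)) \<le>
       C * ((norm z)\<^sup>2 * (1 + norm z) ^ 0 / (1 + norm x) ^ 0)"
    by (rule schwartz_taylor[OF assms(1), of 0]) (rule that)
  show ?thesis
    unfolding convolve_def
  proof (rule has_derivative_integral[where B="\<lambda>v. C * norm (H v)"])
    fix z v :: 'a
    have "\<omega> (x + z - s *\<^sub>R v) * H v - \<omega> (x - s *\<^sub>R v) * H v -
        (\<Sum>b\<in>Basis. (z \<bullet> b) *\<^sub>R (partial b \<omega> (x - s *\<^sub>R v) * H v)) =
      (\<omega> ((x - s *\<^sub>R v) + z) - \<omega> (x - s *\<^sub>R v) - (\<Sum>b\<in>Basis. (z \<bullet> b) *\<^sub>R partial b \<omega> (x - s *\<^sub>R v))) * H v"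
      by (simp add: sum_distrib_left sum_distrib_right algebra_simps)
    also have "norm \<dots> \<le> (C * (norm z)\<^sup>2) * norm (H v)"
      unfolding norm_mult using C[of "x - s *\<^sub>R v" z] by (intro mult_right_mono) auto
    finally show "norm (\<omega> (x + z - s *\<^sub>R v) * H v - \<omega> (x - s *\<^sub>R v) * H v -
        (\<Sum>b\<in>Basis. (z \<bullet> b) *\<^sub>R (partial b \<omega> (x - s *\<^sub>R v) * H v))) \<le> (norm z)\<^sup>2 * (C * norm (H v))"
      by (simp add: mult_ac)
  qed (auto intro!: integrable_convolve schwartz_partial assms)
qed

lemma partial_convolve:
  assumes "\<omega> \<in> schwartz" "integrable lborel H" "b \<in> Basis"
  shows "partial b (convolve \<omega> H s) = convolve (partial b \<omega>) H s"
proof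
  fix x
  show "partial b (convolve \<omega> H s) x = convolve (partial b \<omega>) H s x"
    unfolding partial_eqI[OF convolve_has_derivative[OF assms(1,2)]] using assms(3)
    by (simp add: inner_Basis if_distrib[of "\<lambda>r. r *\<^sub>R _"] sum.delta cong: if_cong)
qed

lemma iter_partial_convolve:
  assumes "\<omega> \<in> schwartz" "integrable lborel H" "set bs \<subseteq> Basis"
  shows "iter_partial bs (convolve \<omega> H s) = convolve (iter_partial bs \<omega>) H s"
  using assms(3)
  by (induction bs) (auto simp: partial_convolve schwartz_iter_partial assms(1,2))

lemma smooth_convolve:
  assumes "\<omega> \<in> schwartz" "integrable lborel H"
  shows "smooth (convolve \<omega> H s)"
proof (rule smooth_coinduct[of _ "(\<lambda>\<omega>. convolve \<omega> H s) ` schwartz"])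
  show "\<eta> differentiable (at x)" if "\<eta> \<in> (\<lambda>\<omega>. convolve \<omega> H s) ` schwartz" for \<eta> x
    using that convolve_has_derivative[OF _ assms(2)] by (auto intro: differentiableI)
  show "partial b \<eta> \<in> (\<lambda>\<omega>. convolve \<omega> H s) ` schwartz"
    if "\<eta> \<in> (\<lambda>\<omega>. convolve \<omega> H s) ` schwartz" "b \<in> Basis" for \<eta> b
    using that by (auto simp: partial_convolve assms(2) schwartz_partial)
qed (use assms in auto)

text \<open>The difference is the integral of (\<omega>(x - s v) - \<omega>(x)) H(v). The weighted
  Lipschitz bound gives a factor s |v| (1 + s |v|)^k, and s at most 1 turns this into s times a
  moment of \<open>H\<close> of order k + 1 that does not depend on s.\<close>

lemma convolve_estimate:
  assumes "\<omega> \<in> schwartz" "rapid H"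
  obtains C where "\<And>s x. 0 \<le> s \<Longrightarrow> s \<le> 1 \<Longrightarrow>
    (1 + norm x) ^ k * norm (convolve \<omega> H s x - (\<integral>v. H v \<partial>lborel) * \<omega> x) \<le> C * s"
proof -
  obtain C where C: "C \<ge> 0" "\<And>x z. norm (\<omega> (x + z) - \<omega> x) \<le> C * (norm z * (1 + norm z) ^ k / (1 + norm x) ^ k)"
    by (rule schwartz_lipschitz[OF assms(1), of k]) (rule that)
  note int = rapid_integrable[OF assms(2)]
  let ?I = "\<integral>v. (1 + norm v) ^ Suc k * norm (H v) \<partial>lborel"
  have "(1 + norm x) ^ k * norm (convolve \<omega> H s x - (\<integral>v. H v \<partial>lborel) * \<omega> x) \<le> (C * ?I) * s"
    if s: "0 \<le> s" "s \<le> 1" for s x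
  proof -
    define w where "w = (1 + norm x) ^ k"
    have w: "w > 0" by (simp add: w_def add_pos_nonneg)
    have "convolve \<omega> H s x - (\<integral>v. H v \<partial>lborel) * \<omega> x = (\<integral>v. \<omega> (x - s *\<^sub>R v) * H v - H v * \<omega> x \<partial>lborel)"
      unfolding convolve_def
      by (subst Bochner_Integration.integral_diff) (auto intro: integrable_convolve assms int)
    also have "norm \<dots> \<le> (\<integral>v. (C * s / w) * ((1 + norm v) ^ Suc k * norm (H v)) \<partial>lborel)"
    proof (rule order_trans[OF integral_norm_bound integral_mono])
      show "integrable lborel (\<lambda>v. norm (\<omega> (x - s *\<^sub>R v) * H v - H v * \<omega> x))"
        by (intro integrable_norm Bochner_Integration.integrable_diff integrable_convolve integrable_mult_left assms int)
      show "integrable lborel (\<lambda>v. (C * s / w) * ((1 + norm v) ^ Suc k * norm (H v)))"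
        by (intro integrable_mult_right rapid_moment assms)
      fix v :: 'a
      have "norm (\<omega> (x + - s *\<^sub>R v) - \<omega> x) \<le> C * (norm (- s *\<^sub>R v) * (1 + norm (- s *\<^sub>R v)) ^ k / w)"
        unfolding w_def by (rule C)
      also have "\<dots> \<le> C * ((s * (1 + norm v)) * (1 + norm v) ^ k / w)"
        using s w C(1) mult_right_mono[OF s(2) norm_ge_zero[of v]]
        by (intro mult_left_mono divide_right_mono mult_mono power_mono) (auto simp: abs_mult mult_left_mono)
      finally have "norm (\<omega> (x - s *\<^sub>R v) - \<omega> x) * norm (H v) \<le> C * ((s * (1 + norm v)) * (1 + norm v) ^ k / w) * norm (H v)"
        by (intro mult_right_mono) auto
      moreover have "\<omega> (x - s *\<^sub>R v) * H v - H v * \<omega> x = (\<omega> (x - s *\<^sub>R v) - \<omega> x) * H v"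
        by (simp add: algebra_simps)
      ultimately show "norm (\<omega> (x - s *\<^sub>R v) * H v - H v * \<omega> x) \<le> (C * s / w) * ((1 + norm v) ^ Suc k * norm (H v))"
        by (simp add: norm_mult mult_ac)
    qed
    also have "\<dots> = (C * ?I) * s / w" by simp
    finally show ?thesis using w unfolding w_def[symmetric] by (simp add: field_simps)
  qed
  then show ?thesis using that by blast
qed

text \<open>Derivatives fall on \<omega>, and by \<open>convolve_estimate\<close> the result differs
  from a multiple of a derivative of \<omega> by a function with the required decay.\<close>

lemma schwartz_convolve:
  assumes "\<omega> \<in> schwartz" "rapid H" "0 \<le> s" "s \<le> 1"
  shows "convolve \<omega> H s \<in> schwartz"
proof (rule schwartzI)
  note int = rapid_integrable[OF assms(2)]
  show "smooth (convolve \<omega> H s)" by (rule smooth_convolve[OF assms(1) int])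
  fix k and bs :: "'a list" assume bs: "set bs \<subseteq> Basis"
  let ?c = "\<integral>v. H v \<partial>lborel"
  obtain C where C': "\<And>s x. 0 \<le> s \<Longrightarrow> s \<le> 1 \<Longrightarrow>
      (1 + norm x) ^ k * norm (convolve (iter_partial bs \<omega>) H s x - ?c * iter_partial bs \<omega> x) \<le> C * s"
    by (rule convolve_estimate[OF schwartz_iter_partial[OF assms(1) bs] assms(2), of k]) (rule that)
  note C = C'[OF assms(3,4)]
  obtain D where D: "\<And>x. (1 + norm x) ^ k * norm (iter_partial bs \<omega> x) \<le> D"
    using schwartz_decay[OF assms(1) bs] by blast
  have "(1 + norm x) ^ k * norm (convolve (iter_partial bs \<omega>) H s x) \<le> C * s + norm ?c * D" for x
  proof -
    have "norm (convolve (iter_partial bs \<omega>) H s x) \<le>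
      norm (convolve (iter_partial bs \<omega>) H s x - ?c * iter_partial bs \<omega> x) + norm ?c * norm (iter_partial bs \<omega> x)"
      by (metis norm_mult norm_triangle_sub add.commute)
    then have "(1 + norm x) ^ k * norm (convolve (iter_partial bs \<omega>) H s x) \<le>
      (1 + norm x) ^ k * (norm (convolve (iter_partial bs \<omega>) H s x - ?c * iter_partial bs \<omega> x) + norm ?c * norm (iter_partial bs \<omega> x))"
      by (intro mult_left_mono) auto
    also have "\<dots> = (1 + norm x) ^ k * norm (convolve (iter_partial bs \<omega>) H s x - ?c * iter_partial bs \<omega> x) +
       norm ?c * ((1 + norm x) ^ k * norm (iter_partial bs \<omega> x))" by (simp add: algebra_simps)
    also have "\<dots> \<le> C * s + norm ?c * D" by (intro add_mono mult_left_mono C D) auto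
    finally show ?thesis .
  qed
  then show "\<exists>C. \<forall>x. (1 + norm x) ^ k * norm (iter_partial bs (convolve \<omega> H s) x) \<le> C"
    unfolding iter_partial_convolve[OF assms(1) int bs] by blast
qed

text \<open>Since convolution commutes with derivatives, \<open>convolve_estimate\<close> bounds
  every seminorm of the error by a constant times 1 / (n + 1). The choice of \<open>Suc n\<close>
  keeps the scale in (0, 1].\<close>

lemma tempered_distribution_convolve:
  fixes f :: "('a::euclidean_space \<Rightarrow> complex) \<Rightarrow> complex"
  assumes f: "tempered_distribution f" and \<omega>: "\<omega> \<in> schwartz" and H: "rapid H"
  shows "(\<lambda>n. f (convolve \<omega> H (1 / real (Suc n)))) \<longlonglongrightarrow> (\<integral>v. H v \<partial>lborel) * f \<omega>"
proof -
  let ?c = "\<integral>v. H v \<partial>lborel"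
  note int = rapid_integrable[OF H]
  have "(\<lambda>n. f (convolve \<omega> H (1 / real (Suc n)))) \<longlonglongrightarrow> f (\<lambda>x. ?c * \<omega> x)"
  proof (rule tempered_distribution_tendsto[OF f])
    show "convolve \<omega> H (1 / real (Suc n)) \<in> schwartz" for n
      by (intro schwartz_convolve \<omega> H) auto
    show "(\<lambda>x. ?c * \<omega> x) \<in> schwartz" by (intro schwartz_scale \<omega>)
    fix k and bs :: "'a list" assume bs: "set bs \<subseteq> Basis"
    obtain C where C: "\<And>s x. 0 \<le> s \<Longrightarrow> s \<le> 1 \<Longrightarrow>
        (1 + norm x) ^ k * norm (convolve (iter_partial bs \<omega>) H s x - ?c * iter_partial bs \<omega> x) \<le> C * s"
      by (rule convolve_estimate[OF schwartz_iter_partial[OF \<omega> bs] H, of k]) (rule that)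
    let ?p = "\<lambda>n. schwartz_seminorm k bs (\<lambda>x. convolve \<omega> H (1 / real (Suc n)) x - ?c * \<omega> x)"
    have up: "?p n \<le> C * (1 / real (Suc n))" for n
      by (rule schwartz_seminorm_le)
        (simp only: iter_partial_lincomb[OF smooth_convolve[OF \<omega> int] schwartz_smooth[OF \<omega>] bs]
          iter_partial_convolve[OF \<omega> int bs], rule C, auto)
    have low: "0 \<le> ?p n" for n
    proof -
      have "0 \<le> (1 + norm (0::'a)) ^ k * norm (iter_partial bs (\<lambda>x. convolve \<omega> H (1 / real (Suc n)) x - ?c * \<omega> x) 0)"
        by simp
      also have "\<dots> \<le> ?p n"
        by (intro le_schwartz_seminorm schwartz_lincomb schwartz_convolve \<omega> H bs) auto
      finally show ?thesis .
    qed
    have "(\<lambda>n. C * (1 / real (Suc n))) \<longlonglongrightarrow> C * 0"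
      by (intro tendsto_intros LIMSEQ_inverse_real_of_nat[unfolded inverse_eq_divide])
    then show "?p \<longlonglongrightarrow> 0"
      unfolding mult_zero_right
      by (rule tendsto_sandwich[OF _ _ tendsto_const, rotated 2]) (intro always_eventually allI low up)+
  qed
  also have "f (\<lambda>x. ?c * \<omega> x) = ?c * f \<omega>" using f \<omega> by (simp add: tempered_distribution_def)
  finally show ?thesis .
qed

text \<open>Put u = x - s v in the integral for \<open>fourier \<omega> (- y)\<close>: together with
  the outer character the phase becomes -2 pi (s y \<bullet> v), a function of s y alone, with
  Jacobian s^d. The substitution z = s y in the outer integral cancels this Jacobian, and exchanging
  the integrals leaves \<open>fourier h\<close> inside.\<close>

lemma fourier_cutoff:
  fixes h \<omega> :: "'a::euclidean_space \<Rightarrow> complex"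
  assumes h: "h \<in> schwartz" and \<omega>: "\<omega> \<in> schwartz" and s: "s > 0"
  shows "fourier (\<lambda>y. h (s *\<^sub>R y) * fourier \<omega> (- y)) = convolve \<omega> (fourier h) s"
proof
  fix x
  have [measurable]: "h \<in> borel_measurable borel" "\<omega> \<in> borel_measurable borel" "fourier \<omega> \<in> borel_measurable borel"
    using h \<omega> by (auto intro: rapid_measurable schwartz_rapid fourier_rapid)
  define d where "d = s ^ DIM('a)"
  define Q where "Q z = h z * (\<integral>v. \<omega> (x - s *\<^sub>R v) * cis (- 2 * pi * (z \<bullet> v)) \<partial>lborel)" for z
  have [measurable]: "Q \<in> borel_measurable borel"
    unfolding Q_def by measurable
  have inner: "fourier \<omega> (- y) * cis (- 2 * pi * (y \<bullet> x)) =
    d *\<^sub>R (\<integral>v. \<omega> (x - s *\<^sub>R v) * cis (- 2 * pi * ((s *\<^sub>R y) \<bullet> v)) \<partial>lborel)" for y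
  proof -
    have "fourier \<omega> (- y) * cis (- 2 * pi * (y \<bullet> x)) =
      (\<integral>u. \<omega> u * (cis (2 * pi * (u \<bullet> y)) * cis (- 2 * pi * (y \<bullet> x))) \<partial>lborel)"
      unfolding fourier_cis by (subst integral_mult_left_zero[symmetric]) (simp add: mult_ac)
    also have "\<dots> = d *\<^sub>R (\<integral>v. \<omega> (x + (- s) *\<^sub>R v) * (cis (2 * pi * ((x + (- s) *\<^sub>R v) \<bullet> y)) * cis (- 2 * pi * (y \<bullet> x))) \<partial>lborel)"
      using s by (subst lborel_integral_affine[of _ "- s" x]) (auto simp: d_def)
    also have "(\<lambda>v. cis (2 * pi * ((x + (- s) *\<^sub>R v) \<bullet> y)) * cis (- 2 * pi * (y \<bullet> x))) = (\<lambda>v. cis (- 2 * pi * ((s *\<^sub>R y) \<bullet> v)))"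
      by (simp add: cis_mult fun_eq_iff inner_add_left inner_commute algebra_simps)
    finally show ?thesis by simp
  qed
  have "fourier (\<lambda>y. h (s *\<^sub>R y) * fourier \<omega> (- y)) x = (\<integral>y. h (s *\<^sub>R y) * (fourier \<omega> (- y) * cis (- 2 * pi * (y \<bullet> x))) \<partial>lborel)"
    unfolding fourier_cis[of _ x] by (simp add: mult.assoc)
  also have "\<dots> = (\<integral>y. d *\<^sub>R Q (0 + s *\<^sub>R y) \<partial>lborel)"
    unfolding inner Q_def by simp
  also have "\<dots> = (\<integral>z. Q z \<partial>lborel)"
    using s by (subst lborel_integral_affine[of Q s 0]) (auto simp: d_def)
  also have "\<dots> = (\<integral>v. \<omega> (x - s *\<^sub>R v) * (\<integral>z. h z * cis (- 2 * pi * (z \<bullet> v)) \<partial>lborel) \<partial>lborel)"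
    unfolding Q_def
  proof (rule integral_cis_swap)
    show "integrable lborel (\<lambda>v. \<omega> (x - s *\<^sub>R v))"
      using lborel_integrable_affine[OF rapid_integrable[OF schwartz_rapid[OF \<omega>]], of "- s" x] s by simp
  qed (auto intro: rapid_integrable schwartz_rapid h)
  also have "\<dots> = convolve \<omega> (fourier h) s x"
    unfolding convolve_def fourier_cis ..
  finally show "fourier (\<lambda>y. h (s *\<^sub>R y) * fourier \<omega> (- y)) x = convolve \<omega> (fourier h) s x" .
qed

section \<open>Pure point measures\<close>

text \<open>The definition of \<open>pure_point\<close> speaks of \<open>has_sum\<close>. Passing to
  integrals over \<open>count_space\<close> makes dominated convergence and comparison available for
  these sums.\<close>

lemma integrable_count_space_iff_summable_norm:
  fixes g :: "'a \<Rightarrow> 'b::{banach, second_countable_topology}"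
  shows "integrable (count_space A) g \<longleftrightarrow> (\<lambda>x. norm (g x)) summable_on A"
  using abs_summable_equivalent[of g A] unfolding Infinite_Set_Sum.abs_summable_on_def by simp

lemma integral_count_space_eq_infsum:
  fixes g :: "'a \<Rightarrow> 'b::{banach, second_countable_topology}"
  assumes "integrable (count_space A) g"
  shows "integral\<^sup>L (count_space A) g = infsum g A"
  using infsetsum_infsum[of g A] assms
  unfolding Infinite_Set_Sum.abs_summable_on_def infsetsum_def by simp

text \<open>For real families, unconditional summability is absolute summability.\<close>

lemma has_sum_count_space_real:
  fixes g :: "'a \<Rightarrow> real"
  assumes "(g has_sum S) A"
  shows "integrable (count_space A) g" "integral\<^sup>L (count_space A) g = S"
proof -
  show *: "integrable (count_space A) g"
    using has_sum_imp_summable[OF assms] summable_on_iff_abs_summable_on_real[of g A]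
    by (simp add: integrable_count_space_iff_summable_norm)
  show "integral\<^sup>L (count_space A) g = S"
    using integral_count_space_eq_infsum[OF *] infsumI[OF assms] by simp
qed

lemma borel_countable: "countable A \<Longrightarrow> A \<in> sets (borel :: 'a::euclidean_space measure)"
  by (rule sets.countable) auto

text \<open>The measure with mass \<open>w l\<close> at each \<open>l\<close> in
  \<open>\<Lambda>\<close>, carried on the Borel sets so that it can equal \<open>jordan_pos\<close>
  as a measure. Negative weights would be cut to 0 by \<open>ennreal\<close>.\<close>

definition point_measure_borel :: "'a::euclidean_space set \<Rightarrow> ('a \<Rightarrow> real) \<Rightarrow> 'a measure" where
  "point_measure_borel \<Lambda> w = distr (density (count_space \<Lambda>) (\<lambda>l. ennreal (w l))) borel (\<lambda>l. l)"

lemma sets_point_measure_borel [simp, measurable_cong]: "sets (point_measure_borel \<Lambda> w) = sets borel"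
  and space_point_measure_borel [simp]: "space (point_measure_borel \<Lambda> w) = UNIV"
  by (simp_all add: point_measure_borel_def)

lemma emeasure_point_measure_borel:
  assumes "E \<in> sets borel"
  shows "emeasure (point_measure_borel \<Lambda> w) E = (\<integral>\<^sup>+l. ennreal (w l) * indicator E l \<partial>count_space \<Lambda>)"
proof -
  have "emeasure (point_measure_borel \<Lambda> w) E = emeasure (density (count_space \<Lambda>) (\<lambda>l. ennreal (w l))) (E \<inter> \<Lambda>)"
    using assms by (simp add: point_measure_borel_def emeasure_distr)
  also have "\<dots> = (\<integral>\<^sup>+l. ennreal (w l) * indicator (E \<inter> \<Lambda>) l \<partial>count_space \<Lambda>)"
    by (subst emeasure_density) auto
  also have "\<dots> = (\<integral>\<^sup>+l. ennreal (w l) * indicator E l \<partial>count_space \<Lambda>)"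
    by (intro nn_integral_cong) (auto simp: indicator_def)
  finally show ?thesis .
qed

lemma
  fixes \<phi> :: "'a::euclidean_space \<Rightarrow> 'b::{banach, second_countable_topology}"
  assumes [measurable]: "\<phi> \<in> borel_measurable borel" and "\<And>l. 0 \<le> w l"
  shows integral_point_measure_borel:
    "integral\<^sup>L (point_measure_borel \<Lambda> w) \<phi> = (\<integral>l. w l *\<^sub>R \<phi> l \<partial>count_space \<Lambda>)"
    and integrable_point_measure_borel:
    "integrable (point_measure_borel \<Lambda> w) \<phi> \<longleftrightarrow> integrable (count_space \<Lambda>) (\<lambda>l. w l *\<^sub>R \<phi> l)"
  unfolding point_measure_borel_def using assms(2)
  by (simp_all add: integral_distr integrable_distr_eq integral_density integrable_density)

text \<open>On the one hand the value on F is at most the sum of the positive weights in F. On the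
  other hand the supremum is approached by the sets of atoms in E with positive weight.\<close>

lemma jordan_pos_pure_point:
  fixes b :: "'a::euclidean_space \<Rightarrow> real"
  assumes "countable \<Lambda>"
    and \<nu>: "\<And>E. E \<in> bounded_borel \<Longrightarrow> ((\<lambda>l. b l * indicator E l) has_sum \<nu> E) \<Lambda>"
  shows "jordan_pos \<nu> = point_measure_borel \<Lambda> (\<lambda>l. max 0 (b l))"
proof -
  let ?D = "point_measure_borel \<Lambda> (\<lambda>l. max 0 (b l))"
  note int = has_sum_count_space_real[OF \<nu>]
  have eq: "(SUP F \<in> {F \<in> bounded_borel. F \<subseteq> E}. ennreal (\<nu> F)) = emeasure ?D E" if E: "E \<in> sets borel" for E
  proof (rule antisym)
    show "(SUP F \<in> {F \<in> bounded_borel. F \<subseteq> E}. ennreal (\<nu> F)) \<le> emeasure ?D E"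
    proof (rule SUP_least)
      fix F assume "F \<in> {F \<in> bounded_borel. F \<subseteq> E}"
      then have F: "F \<in> bounded_borel" "F \<subseteq> E" "F \<in> sets borel" by (auto simp: bounded_borel_def)
      have i: "integrable (count_space \<Lambda>) (\<lambda>l. max 0 (b l) * indicator F l)"
        by (rule Bochner_Integration.integrable_bound[OF int(1)[OF F(1)]]) (auto simp: indicator_def)
      have "\<nu> F \<le> (\<integral>l. max 0 (b l) * indicator F l \<partial>count_space \<Lambda>)"
        unfolding int(2)[OF F(1), symmetric]
        by (intro integral_mono int(1)[OF F(1)] i) (auto simp: indicator_def)
      then have "ennreal (\<nu> F) \<le> ennreal (\<integral>l. max 0 (b l) * indicator F l \<partial>count_space \<Lambda>)"
        by (rule ennreal_leI)
      also have "\<dots> = (\<integral>\<^sup>+l. ennreal (max 0 (b l) * indicator F l) \<partial>count_space \<Lambda>)"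
        by (rule nn_integral_eq_integral[symmetric, OF i]) auto
      also have "\<dots> = emeasure ?D F"
        unfolding emeasure_point_measure_borel[OF F(3)]
        by (intro nn_integral_cong) (auto simp: indicator_def)
      also have "\<dots> \<le> emeasure ?D E" using F E by (intro emeasure_mono) auto
      finally show "ennreal (\<nu> F) \<le> emeasure ?D E" .
    qed
    \<comment> \<open>Cutting with balls keeps the sets bounded, where the values of \<nu> are
      prescribed; continuity from below recovers the whole set.\<close>
    define A where "A n = {l \<in> \<Lambda>. b l > 0 \<and> l \<in> E} \<inter> ball 0 (real n)" for n
    have cA: "countable (A n)" for n
      by (rule countable_subset[OF _ assms(1)]) (auto simp: A_def)
    then have A: "A n \<in> sets borel" "A n \<in> bounded_borel" "A n \<subseteq> E" for n
      using bounded_subset[OF bounded_ball, of "A n" 0 "real n"] borel_countable[of "A n"]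
      by (auto simp: bounded_borel_def A_def)
    have UA: "(\<Union>n. A n) = {l \<in> \<Lambda>. b l > 0 \<and> l \<in> E}"
      using reals_Archimedean2 by (fastforce simp: A_def)
    have "{l \<in> \<Lambda>. b l > 0 \<and> l \<in> E} \<in> sets borel"
      by (rule borel_countable, rule countable_subset[OF _ assms(1)]) auto
    then have "emeasure ?D E = emeasure ?D {l \<in> \<Lambda>. b l > 0 \<and> l \<in> E}"
      using E by (simp only: emeasure_point_measure_borel)
        (intro nn_integral_cong, auto simp: indicator_def max_def)
    also have "\<dots> = emeasure ?D (\<Union>n. A n)" by (simp only: UA)
    also have "\<dots> = (SUP n. emeasure ?D (A n))"
      by (rule SUP_emeasure_incseq[symmetric]) (use A in \<open>auto simp: incseq_def A_def\<close>)
    also have "\<dots> \<le> (SUP F \<in> {F \<in> bounded_borel. F \<subseteq> E}. ennreal (\<nu> F))"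
    proof (rule SUP_least)
      fix n
      have "emeasure ?D (A n) = (\<integral>\<^sup>+l. ennreal (b l * indicator (A n) l) \<partial>count_space \<Lambda>)"
        unfolding emeasure_point_measure_borel[OF A(1)]
        by (intro nn_integral_cong) (auto simp: indicator_def A_def)
      also have "\<dots> = ennreal (\<integral>l. b l * indicator (A n) l \<partial>count_space \<Lambda>)"
        by (rule nn_integral_eq_integral[OF int(1)[OF A(2)]]) (auto simp: indicator_def A_def)
      also have "\<dots> = ennreal (\<nu> (A n))" by (simp add: int(2)[OF A(2)])
      also have "\<dots> \<le> (SUP F \<in> {F \<in> bounded_borel. F \<subseteq> E}. ennreal (\<nu> F))"
        using A by (intro SUP_upper) auto
      finally show "emeasure ?D (A n) \<le> \<dots>" .
    qed
    finally show "emeasure ?D E \<le> (SUP F \<in> {F \<in> bounded_borel. F \<subseteq> E}. ennreal (\<nu> F))" .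
  qed
  \<comment> \<open>\<open>measure_of\<close> yields the zero measure for a set function that is not
    countably additive; agreement with an actual measure on all Borel sets excludes this.\<close>
  have "jordan_pos \<nu> = measure_of UNIV (sets borel) (emeasure ?D)"
    unfolding jordan_pos_def
  proof (rule measure_of_eq)
    fix a :: "'a set" assume "a \<in> sigma_sets UNIV (sets borel)"
    then have "a \<in> sets borel" using sets.sigma_sets_eq[of "borel :: 'a measure"] by simp
    then show "(SUP F \<in> {F \<in> bounded_borel. F \<subseteq> a}. ennreal (\<nu> F)) = emeasure ?D a" by (rule eq)
  qed simp
  also have "\<dots> = ?D" using measure_of_of_measure[of ?D] by simp
  finally show ?thesis .
qed

text \<open>The four positive parts of \<open>\<mu>\<close> have as weights the positive parts of Re
  a, -Re a, Im a and -Im a. Each is at most |a|, so the four integrals converge and recombine to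
  a.\<close>

lemma cmeasure_integral_pure_point:
  fixes a \<phi> :: "'a::euclidean_space \<Rightarrow> complex"
  assumes \<Lambda>: "countable \<Lambda>"
    and \<mu>: "\<And>E. E \<in> bounded_borel \<Longrightarrow> ((\<lambda>l. a l * indicator E l) has_sum \<mu> E) \<Lambda>"
    and [measurable]: "\<phi> \<in> borel_measurable borel" and int: "integrable (count_space \<Lambda>) (\<lambda>l. a l * \<phi> l)"
  shows "cmeasure_integral \<mu> \<phi> = (\<integral>l. a l * \<phi> l \<partial>count_space \<Lambda>)"
proof -
  have Re: "((\<lambda>l. Re (a l) * indicator E l) has_sum Re (\<mu> E)) \<Lambda>"
    and Im: "((\<lambda>l. Im (a l) * indicator E l) has_sum Im (\<mu> E)) \<Lambda>" if "E \<in> bounded_borel" for E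
  proof -
    have "Re (a l * indicator E l) = Re (a l) * indicator E l"
      and "Im (a l * indicator E l) = Im (a l) * indicator E l" for l
      by (auto simp: indicator_def)
    then show "((\<lambda>l. Re (a l) * indicator E l) has_sum Re (\<mu> E)) \<Lambda>"
      and "((\<lambda>l. Im (a l) * indicator E l) has_sum Im (\<mu> E)) \<Lambda>"
      using has_sum_Re[OF \<mu>[OF that]] has_sum_Im[OF \<mu>[OF that]] by (simp_all only:)
  qed
  have neg: "((\<lambda>l. - r l * indicator E l) has_sum - s) \<Lambda>"
    if "((\<lambda>l. r l * indicator E l) has_sum s) \<Lambda>" for r :: "'a \<Rightarrow> real" and s E
    using that by (simp add: has_sum_uminus)
  have i: "integrable (count_space \<Lambda>) (\<lambda>l. max 0 (r l) *\<^sub>R \<phi> l)" if "\<And>l. \<bar>r l\<bar> \<le> cmod (a l)" for r :: "'a \<Rightarrow> real"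
  proof (rule Bochner_Integration.integrable_bound[OF int])
    have "norm (max 0 (r l) *\<^sub>R \<phi> l) \<le> norm (a l * \<phi> l)" for l
      using that[of l] by (auto simp: norm_mult intro!: mult_right_mono)
    then show "AE l in count_space \<Lambda>. norm (max 0 (r l) *\<^sub>R \<phi> l) \<le> norm (a l * \<phi> l)" by simp
  qed simp
  note i' = i[of "\<lambda>l. Re (a l)", OF abs_Re_le_cmod] i[of "\<lambda>l. - Re (a l)", simplified, OF abs_Re_le_cmod]
    i[of "\<lambda>l. Im (a l)", OF abs_Im_le_cmod] i[of "\<lambda>l. - Im (a l)", simplified, OF abs_Im_le_cmod]
  have split: "a l * \<phi> l = max 0 (Re (a l)) *\<^sub>R \<phi> l - max 0 (- Re (a l)) *\<^sub>R \<phi> l +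
      \<i> * (max 0 (Im (a l)) *\<^sub>R \<phi> l - max 0 (- Im (a l)) *\<^sub>R \<phi> l)" for l
  proof -
    have "a l = of_real (max 0 (Re (a l)) - max 0 (- Re (a l))) + \<i> * of_real (max 0 (Im (a l)) - max 0 (- Im (a l)))"
      by (simp add: complex_eq_iff max_def)
    then have "a l * \<phi> l = (of_real (max 0 (Re (a l)) - max 0 (- Re (a l))) + \<i> * of_real (max 0 (Im (a l)) - max 0 (- Im (a l)))) * \<phi> l"
      by (rule arg_cong)
    also have "\<dots> = max 0 (Re (a l)) *\<^sub>R \<phi> l - max 0 (- Re (a l)) *\<^sub>R \<phi> l +
      \<i> * (max 0 (Im (a l)) *\<^sub>R \<phi> l - max 0 (- Im (a l)) *\<^sub>R \<phi> l)"
      by (simp only: scaleR_conv_of_real of_real_diff ring_distribs mult.assoc right_diff_distrib left_diff_distrib)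
    finally show ?thesis .
  qed
  have J: "jordan_pos (\<lambda>E. Re (\<mu> E)) = point_measure_borel \<Lambda> (\<lambda>l. max 0 (Re (a l)))"
    "jordan_pos (\<lambda>E. - Re (\<mu> E)) = point_measure_borel \<Lambda> (\<lambda>l. max 0 (- Re (a l)))"
    "jordan_pos (\<lambda>E. Im (\<mu> E)) = point_measure_borel \<Lambda> (\<lambda>l. max 0 (Im (a l)))"
    "jordan_pos (\<lambda>E. - Im (\<mu> E)) = point_measure_borel \<Lambda> (\<lambda>l. max 0 (- Im (a l)))"
    by (rule jordan_pos_pure_point[OF \<Lambda>], erule Re neg[OF Re] Im neg[OF Im])+
  have "cmeasure_integral \<mu> \<phi> =
    (\<integral>l. max 0 (Re (a l)) *\<^sub>R \<phi> l \<partial>count_space \<Lambda>) - (\<integral>l. max 0 (- Re (a l)) *\<^sub>R \<phi> l \<partial>count_space \<Lambda>) +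
    \<i> * ((\<integral>l. max 0 (Im (a l)) *\<^sub>R \<phi> l \<partial>count_space \<Lambda>) - (\<integral>l. max 0 (- Im (a l)) *\<^sub>R \<phi> l \<partial>count_space \<Lambda>))"
    unfolding cmeasure_integral_def J by (simp add: integral_point_measure_borel)
  also have "\<dots> = (\<integral>l. a l * \<phi> l \<partial>count_space \<Lambda>)"
    unfolding split
    by (simp only: i' Bochner_Integration.integral_diff Bochner_Integration.integral_add
        Bochner_Integration.integrable_diff integral_mult_right_zero integrable_mult_right)
  finally show ?thesis .
qed

section \<open>Bounds on the atoms by the variation\<close>

lemma variation_mono: "E \<subseteq> F \<Longrightarrow> variation \<mu> E \<le> variation \<mu> F"
  unfolding variation_def by (rule SUP_subset_mono) auto

text \<open>The singletons of F form an admissible disjoint family, and the measure of each is its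
  weight.\<close>

lemma sum_norm_le_variation:
  assumes \<mu>: "\<And>E. E \<in> bounded_borel \<Longrightarrow> ((\<lambda>l. a l * indicator E l) has_sum \<mu> E) \<Lambda>"
    and "finite F" "F \<subseteq> \<Lambda>" "F \<subseteq> E"
  shows "ennreal (\<Sum>l\<in>F. cmod (a l)) \<le> variation \<mu> E"
proof -
  have \<mu>1: "\<mu> {l} = a l" if "l \<in> \<Lambda>" for l
  proof (rule has_sum_unique)
    show "((\<lambda>x. a x * indicator {l} x) has_sum \<mu> {l}) \<Lambda>"
      by (rule \<mu>) (simp add: bounded_borel_def)
    show "((\<lambda>x. a x * indicator {l} x) has_sum a l) \<Lambda>"
      by (rule has_sum_finite_neutralI[of "{l}"]) (use that in auto)
  qed
  have "(\<Sum>l\<in>F. cmod (a l)) = (\<Sum>P\<in>(\<lambda>l. {l}) ` F. cmod (\<mu> P))"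
    using \<mu>1 assms(3) by (subst sum.reindex) (auto intro!: sum.cong simp: subset_iff)
  then show ?thesis
    unfolding variation_def using assms
    by (intro SUP_upper2[of "(\<lambda>l. {l}) ` F"]) (auto simp: bounded_borel_def disjoint_def)
qed

lemma emeasure_le_variation:
  fixes a :: "'a::euclidean_space \<Rightarrow> complex"
  assumes \<mu>: "\<And>E. E \<in> bounded_borel \<Longrightarrow> ((\<lambda>l. a l * indicator E l) has_sum \<mu> E) \<Lambda>"
    and E: "E \<in> bounded_borel" and fin: "variation \<mu> E < \<infinity>"
  shows "emeasure (point_measure_borel \<Lambda> (\<lambda>l. cmod (a l))) E \<le> variation \<mu> E"
proof -
  let ?g = "\<lambda>l. cmod (a l) * indicator E l"
  have E': "E \<in> sets borel" using E by (simp add: bounded_borel_def)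
  have "(\<lambda>l. norm (a l * indicator E l)) summable_on \<Lambda>"
    by (rule summable_on_iff_abs_summable_on_complex[THEN iffD1, OF has_sum_imp_summable[OF \<mu>[OF E]]])
  moreover have "(\<lambda>l. norm (a l * indicator E l)) = ?g" by (auto simp: indicator_def)
  ultimately have s: "?g summable_on \<Lambda>" by (simp only:)
  moreover have "(\<lambda>l. norm (?g l)) = ?g" by (auto simp: indicator_def)
  ultimately have int: "integrable (count_space \<Lambda>) ?g"
    by (simp only: integrable_count_space_iff_summable_norm)
  have "emeasure (point_measure_borel \<Lambda> (\<lambda>l. cmod (a l))) E = (\<integral>\<^sup>+l. ennreal (?g l) \<partial>count_space \<Lambda>)"
    unfolding emeasure_point_measure_borel[OF E'] by (intro nn_integral_cong) (auto simp: indicator_def)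
  also have "\<dots> = ennreal (infsum ?g \<Lambda>)"
    using nn_integral_eq_integral[OF int] integral_count_space_eq_infsum[OF int] by simp
  \<comment> \<open>The sum is a real number bounded through its finite partial sums; passing to
    \<open>enn2real\<close> loses nothing because the variation is finite.\<close>
  also have "\<dots> \<le> ennreal (enn2real (variation \<mu> E))"
  proof (intro ennreal_leI infsum_le_finite_sums s)
    fix F assume F: "finite F" "F \<subseteq> \<Lambda>"
    have "sum ?g F = (\<Sum>l\<in>F \<inter> E. cmod (a l))"
      using F by (simp add: sum.inter_restrict indicator_def if_distrib cong: if_cong)
    moreover have "ennreal (\<Sum>l\<in>F \<inter> E. cmod (a l)) \<le> ennreal (enn2real (variation \<mu> E))"
      using sum_norm_le_variation[OF \<mu>, of "F \<inter> E" E] F fin by auto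
    ultimately show "sum ?g F \<le> enn2real (variation \<mu> E)"
      by (simp add: ennreal_le_iff)
  qed
  also have "\<dots> = variation \<mu> E" using fin by simp
  finally show ?thesis .
qed

lemma integrable_pure_point_weight:
  fixes a :: "'a::euclidean_space \<Rightarrow> complex"
  assumes \<mu>: "\<And>E. E \<in> bounded_borel \<Longrightarrow> ((\<lambda>l. a l * indicator E l) has_sum \<mu> E) \<Lambda>"
    and fin: "\<And>E. E \<in> bounded_borel \<Longrightarrow> variation \<mu> E < \<infinity>"
    and growth: "(\<lambda>r. enn2real (variation \<mu> (ball 0 r))) \<in> O(\<lambda>r. r powr T)"
  obtains N where "integrable (count_space \<Lambda>) (\<lambda>l. cmod (a l) / (1 + norm l) ^ N)"
proof -
  define V where "V r = enn2real (variation \<mu> (ball (0::'a) r))" for r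
  have bb: "ball (0::'a) r \<in> bounded_borel" for r by (simp add: bounded_borel_def)
  obtain c r0 where c: "c > 0" "\<And>r. r \<ge> r0 \<Longrightarrow> V r \<le> c * r powr T"
    using growth unfolding V_def by (elim landau_o.bigE) (auto simp: eventually_at_top_linorder)
  \<comment> \<open>An integer exponent replaces T for radii at least 1; a negative T gives m =
    0.\<close>
  define m where "m = nat \<lceil>T\<rceil>"
  have m: "r powr T \<le> r ^ m" if "r \<ge> 1" for r
  proof -
    have "T \<le> real m" unfolding m_def by linarith
    then have "r powr T \<le> r powr real m" using that by (intro powr_mono) auto
    then show ?thesis using that by (simp add: powr_realpow)
  qed
  \<comment> \<open>The growth bound holds only from \<open>r0\<close> on. For smaller radii
    monotonicity of the variation gives the bound \<open>V (max r0 1)\<close>.\<close>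
  define C where "C = max c (V (max r0 1))"
  have C: "C \<ge> 0" using c by (simp add: C_def)
  have V: "V (real n + 1) \<le> C * (real n + 1) ^ m" for n
  proof (cases "real n + 1 \<ge> r0")
    case True
    have "V (real n + 1) \<le> c * (real n + 1) powr T" by (rule c(2)[OF True])
    also have "\<dots> \<le> C * (real n + 1) ^ m"
      using C by (intro mult_mono m) (auto simp: C_def)
    finally show ?thesis .
  next
    case False
    have "V (real n + 1) \<le> V (max r0 1)"
      unfolding V_def using fin[OF bb] False
      by (intro enn2real_mono variation_mono subset_ball) auto
    also have "\<dots> \<le> C * 1" by (simp add: C_def)
    also have "\<dots> \<le> C * (real n + 1) ^ m" using C by (intro mult_left_mono one_le_power) auto
    finally show ?thesis .
  qed
  have "integrable (point_measure_borel \<Lambda> (\<lambda>l. cmod (a l))) (\<lambda>l. 1 / (1 + norm l) ^ (m + 2))"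
  proof (rule integrable_weight[OF _ _ C])
    fix n
    have "emeasure (point_measure_borel \<Lambda> (\<lambda>l. cmod (a l))) (ball 0 (real n + 1)) \<le> variation \<mu> (ball 0 (real n + 1))"
      by (rule emeasure_le_variation[OF \<mu> bb fin[OF bb]])
    also have "\<dots> = ennreal (V (real n + 1))" using fin[OF bb] by (simp add: V_def)
    also have "\<dots> \<le> ennreal (C * (real n + 1) ^ m)" by (intro ennreal_leI V)
    finally show "emeasure (point_measure_borel \<Lambda> (\<lambda>l. cmod (a l))) (ball 0 (real n + 1)) \<le> \<dots>" .
  qed simp
  then have "integrable (count_space \<Lambda>) (\<lambda>l. cmod (a l) *\<^sub>R (1 / (1 + norm l) ^ (m + 2)))"
    by (subst (asm) integrable_point_measure_borel) auto
  then show ?thesis using that[of "m + 2"] by simp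
qed

section \<open>Almost periodicity\<close>

text \<open>A pigeonhole argument: the fractional parts of x \<bullet> l for l in F place x in one
  of finitely many cells of a torus. Subtracting from x a fixed representative of its cell moves it
  by a bounded amount and gives a common almost period of all the characters.\<close>

lemma relatively_dense_simultaneous:
  fixes F :: "'a::euclidean_space set"
  assumes "finite F" "d > 0"
  shows "relatively_dense {\<tau>. \<forall>l\<in>F. cmod (cis (2 * pi * (\<tau> \<bullet> l)) - 1) < d}"
proof -
  \<comment> \<open>In a common cell the fractional parts differ by less than 1/N, so the phases
    differ by less than 2 pi / N, which is less than d.\<close>
  obtain N :: nat where N: "2 * pi / d < real N" using reals_Archimedean2 by blast
  have Np: "real N > 0" using N assms(2) by (smt (verit) divide_nonneg_pos pi_gt_zero)
  define cell where "cell x = restrict (\<lambda>l. \<lfloor>real N * frac (x \<bullet> l)\<rfloor>) F" for x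
  have "range cell \<subseteq> F \<rightarrow>\<^sub>E {0..<int N}"
  proof (rule image_subsetI, rule PiE_I)
    fix x l assume l: "l \<in> F"
    have "0 \<le> frac (x \<bullet> l)" "frac (x \<bullet> l) < 1" by (simp_all add: frac_lt_1)
    then have "0 \<le> real N * frac (x \<bullet> l)" "real N * frac (x \<bullet> l) < real N * 1"
      using Np by (auto simp del: mult_1_right)
    then show "cell x l \<in> {0..<int N}" using l by (auto simp: cell_def floor_less_iff)
  qed (simp add: cell_def)
  then have fin: "finite (range cell)"
    by (rule finite_subset) (intro finite_PiE assms(1), simp)
  define rep where "rep v = (SOME x. cell x = v)" for v
  have rep: "cell (rep (cell x)) = cell x" for x
    unfolding rep_def by (rule someI) simp
  \<comment> \<open>The sum over the finitely many cells bounds each representative; the summand 1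
    makes the inequality strict, as an open ball requires.\<close>
  define R where "R = (\<Sum>v\<in>range cell. norm (rep v)) + 1"
  have R: "norm (rep (cell x)) < R" for x
    using member_le_sum[of "cell x" "range cell" "\<lambda>v. norm (rep v)"] fin by (auto simp: R_def)
  have "{\<tau>. \<forall>l\<in>F. cmod (cis (2 * pi * (\<tau> \<bullet> l)) - 1) < d} \<inter> ball x R \<noteq> {}" for x
  proof -
    define \<sigma> where "\<sigma> = rep (cell x)"
    have "cmod (cis (2 * pi * ((x - \<sigma>) \<bullet> l)) - 1) < d" if l: "l \<in> F" for l
    proof -
      define r where "r = frac (x \<bullet> l) - frac (\<sigma> \<bullet> l)"
      define k where "k = \<lfloor>x \<bullet> l\<rfloor> - \<lfloor>\<sigma> \<bullet> l\<rfloor>"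
      have "2 * pi * ((x - \<sigma>) \<bullet> l) = 2 * pi * r + 2 * pi * of_int k"
        by (simp add: r_def k_def frac_def inner_diff_left algebra_simps)
      then have cis: "cis (2 * pi * ((x - \<sigma>) \<bullet> l)) = cis (2 * pi * r)"
        by (simp add: cis_mult[symmetric] cis_multiple_2pi)
      have "\<lfloor>real N * frac (x \<bullet> l)\<rfloor> = \<lfloor>real N * frac (\<sigma> \<bullet> l)\<rfloor>"
        using fun_cong[OF rep[of x], of l] l by (simp add: \<sigma>_def[symmetric]) (simp add: cell_def)
      then have "\<bar>real N * frac (x \<bullet> l) - real N * frac (\<sigma> \<bullet> l)\<bar> < 1" by linarith
      then have "\<bar>real N * r\<bar> < 1" unfolding r_def by (simp only: right_diff_distrib)
      then have "\<bar>r\<bar> < 1 / real N"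
        unfolding abs_mult using Np by (simp add: pos_less_divide_eq mult.commute)
      have "cmod (cis (2 * pi * r) - 1) \<le> 2 * pi * \<bar>r\<bar>"
        using norm_cis_minus_1[of "2 * pi * r"] by (simp add: abs_mult)
      also have "\<dots> < 2 * pi * (1 / real N)"
        using \<open>\<bar>r\<bar> < 1 / real N\<close> by (intro mult_strict_left_mono) auto
      also have "\<dots> < d" using N Np assms(2) by (simp add: field_simps)
      finally show ?thesis by (simp add: cis)
    qed
    moreover have "x - \<sigma> \<in> ball x R" using R[of x] by (simp add: \<sigma>_def dist_norm)
    ultimately show ?thesis by blast
  qed
  then show ?thesis unfolding relatively_dense_def by blast
qed

lemma relatively_dense_mono: "relatively_dense A \<Longrightarrow> A \<subseteq> B \<Longrightarrow> relatively_dense B"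
  unfolding relatively_dense_def by blast

lemma almost_periodic_fourier_series:
  fixes c :: "'a::euclidean_space \<Rightarrow> complex"
  assumes c: "integrable (count_space \<Lambda>) c"
  shows "almost_periodic (\<lambda>t. \<integral>l. c l * cis (2 * pi * (t \<bullet> l)) \<partial>count_space \<Lambda>)"
proof -
  define g where "g t = (\<integral>l. c l * cis (2 * pi * (t \<bullet> l)) \<partial>count_space \<Lambda>)" for t
  define I where "I = (\<integral>l. cmod (c l) \<partial>count_space \<Lambda>)"
  have I: "I \<ge> 0" by (simp add: I_def)
  have int: "integrable (count_space \<Lambda>) (\<lambda>l. c l * cis (2 * pi * (t \<bullet> l)))" for t
    by (rule Bochner_Integration.integrable_bound[OF c]) (auto simp: norm_mult)
  \<comment> \<open>Both continuity and almost periodicity come from this estimate: a shift that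
    nearly fixes finitely many characters moves g by little, uniformly in t. Small shifts have this
    property, and so does a relatively dense set of shifts.\<close>
  have est: "\<exists>F d. finite F \<and> d > 0 \<and>
      (\<forall>\<tau>. (\<forall>l\<in>F. cmod (cis (2 * pi * (\<tau> \<bullet> l)) - 1) < d) \<longrightarrow> (\<forall>t. cmod (g (t + \<tau>) - g t) \<le> e))"
    if "e > 0" for e :: real
  proof -
    have "((\<lambda>l. cmod (c l)) has_sum I) \<Lambda>"
      using c has_sum_infsum[of "\<lambda>l. cmod (c l)" \<Lambda>] integral_count_space_eq_infsum[OF integrable_norm[OF c]]
      by (simp add: I_def integrable_count_space_iff_summable_norm)
    then have "\<forall>\<^sub>F F in finite_subsets_at_top \<Lambda>. dist (\<Sum>l\<in>F. cmod (c l)) I < e / 4"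
      unfolding has_sum_def using \<open>e > 0\<close> by (intro tendstoD) auto
    then obtain F where F: "finite F" "F \<subseteq> \<Lambda>" "dist (\<Sum>l\<in>F. cmod (c l)) I < e / 4"
      unfolding eventually_finite_subsets_at_top by blast
    \<comment> \<open>Chosen so that d * I is at most e/2; the summand 1 guards against I =
      0.\<close>
    define d where "d = e / (2 * (I + 1))"
    have d: "d > 0" using \<open>e > 0\<close> I by (simp add: d_def)
    have iF: "integrable (count_space \<Lambda>) (\<lambda>l. cmod (c l) * indicator F l)"
      by (rule Bochner_Integration.integrable_bound[OF c]) (auto simp: indicator_def)
    have "(\<integral>l. cmod (c l) * indicator F l \<partial>count_space \<Lambda>) = (\<Sum>l\<in>F. cmod (c l))"
      unfolding integral_count_space_eq_infsum[OF iF]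
      by (rule infsumI, rule has_sum_finite_neutralI[OF F(1,2)]) auto
    then have tail: "I - (\<integral>l. cmod (c l) * indicator F l \<partial>count_space \<Lambda>) < e / 4"
      using F(3) unfolding dist_real_def by linarith
    have "cmod (g (t + \<tau>) - g t) \<le> e" if \<tau>: "\<And>l. l \<in> F \<Longrightarrow> cmod (cis (2 * pi * (\<tau> \<bullet> l)) - 1) < d" for \<tau> t
    proof -
      have "g (t + \<tau>) - g t =
          (\<integral>l. c l * cis (2 * pi * ((t + \<tau>) \<bullet> l)) - c l * cis (2 * pi * (t \<bullet> l)) \<partial>count_space \<Lambda>)"
        unfolding g_def by (rule Bochner_Integration.integral_diff[OF int int, symmetric])
      \<comment> \<open>The first term pays for the frequencies in F. The second is twice the
        modulus of the coefficients outside F, where the characters move by at most 2.\<close>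
      also have "cmod \<dots> \<le> (\<integral>l. d * cmod (c l) + 2 * (cmod (c l) - cmod (c l) * indicator F l) \<partial>count_space \<Lambda>)"
      proof (rule order_trans[OF integral_norm_bound integral_mono])
        fix l assume "l \<in> space (count_space \<Lambda>)"
        have "c l * cis (2 * pi * ((t + \<tau>) \<bullet> l)) - c l * cis (2 * pi * (t \<bullet> l)) =
          c l * cis (2 * pi * (t \<bullet> l)) * (cis (2 * pi * (\<tau> \<bullet> l)) - 1)"
          by (simp add: inner_add_left distrib_left cis_mult[symmetric] algebra_simps)
        then have eq: "cmod (c l * cis (2 * pi * ((t + \<tau>) \<bullet> l)) - c l * cis (2 * pi * (t \<bullet> l))) =
            cmod (c l) * cmod (cis (2 * pi * (\<tau> \<bullet> l)) - 1)"
          by (simp add: norm_mult)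
        show "cmod (c l * cis (2 * pi * ((t + \<tau>) \<bullet> l)) - c l * cis (2 * pi * (t \<bullet> l))) \<le>
            d * cmod (c l) + 2 * (cmod (c l) - cmod (c l) * indicator F l)"
        proof (cases "l \<in> F")
          case True
          then show ?thesis
            unfolding eq using mult_left_mono[OF less_imp_le[OF \<tau>[OF True]], of "cmod (c l)"]
            by (simp add: mult.commute)
        next
          case False
          have "cmod (cis (2 * pi * (\<tau> \<bullet> l)) - 1) \<le> 2"
            using norm_triangle_ineq4[of "cis (2 * pi * (\<tau> \<bullet> l))" 1] by simp
          from mult_left_mono[OF this, of "cmod (c l)"] show ?thesis
            unfolding eq using False d by (simp add: mult.commute add_increasing)
        qed
      qed (intro integrable_norm Bochner_Integration.integrable_diff Bochner_Integration.integrable_add integrable_mult_right int iF c)+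
      also have "\<dots> = d * I + 2 * (I - (\<integral>l. cmod (c l) * indicator F l \<partial>count_space \<Lambda>))"
        using c iF by (simp add: I_def)
      also have "\<dots> \<le> e / 2 + 2 * (e / 4)"
      proof (rule add_mono)
        have "d * I \<le> d * (I + 1)" using d by (intro mult_left_mono) auto
        also have "\<dots> = e / 2" using I by (simp add: d_def field_simps)
        finally show "d * I \<le> e / 2" .
        show "2 * (I - (\<integral>l. cmod (c l) * indicator F l \<partial>count_space \<Lambda>)) \<le> 2 * (e / 4)"
          by (rule mult_left_mono[OF less_imp_le[OF tail]]) simp
      qed
      finally show ?thesis by simp
    qed
    then show ?thesis using F(1) d by (intro exI[of _ F] exI[of _ d]) simp
  qed
  have "continuous_on UNIV g"
    unfolding continuous_on_iff
  proof (intro ballI allI impI)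
    fix t :: 'a and e :: real assume "e > 0"
    then obtain F d where F: "finite F" "d > 0"
      "\<And>\<tau> t. (\<forall>l\<in>F. cmod (cis (2 * pi * (\<tau> \<bullet> l)) - 1) < d) \<Longrightarrow> cmod (g (t + \<tau>) - g t) \<le> e / 2"
      using est[of "e / 2"] by auto
    \<comment> \<open>\<open>L\<close> bounds every frequency in F, so a shift of length less than d
      / (2 pi L) changes each of these characters by less than d.\<close>
    define L where "L = (\<Sum>l\<in>F. norm l) + 1"
    have L: "L > 0" by (simp add: L_def sum_nonneg add_nonneg_pos)
    have "dist (g t') (g t) < e" if t': "dist t' t < d / (2 * pi * L)" for t'
    proof -
      have "cmod (cis (2 * pi * ((t' - t) \<bullet> l)) - 1) < d" if l: "l \<in> F" for l
      proof -
        have "norm l \<le> L"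
          using member_le_sum[OF l, of norm] F(1) by (simp add: L_def)
        have "cmod (cis (2 * pi * ((t' - t) \<bullet> l)) - 1) \<le> 2 * pi * \<bar>(t' - t) \<bullet> l\<bar>"
          using norm_cis_minus_1[of "2 * pi * ((t' - t) \<bullet> l)"] by (simp add: abs_mult)
        also have "\<dots> \<le> 2 * pi * (dist t' t * L)"
          using \<open>norm l \<le> L\<close>
          by (intro mult_left_mono order_trans[OF Cauchy_Schwarz_ineq2]) (auto simp: dist_norm mult_left_mono)
        also have "\<dots> < d" using t' L by (simp add: field_simps)
        finally show ?thesis .
      qed
      then have "cmod (g (t + (t' - t)) - g t) \<le> e / 2" by (intro F(3)) blast
      then show ?thesis using \<open>e > 0\<close> by (simp add: dist_norm)
    qed
    then show "\<exists>\<delta>>0. \<forall>t'\<in>UNIV. dist t' t < \<delta> \<longrightarrow> dist (g t') (g t) < e"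
      using F(2) L by (intro exI[of _ "d / (2 * pi * L)"]) auto
  qed
  moreover have "relatively_dense {\<tau>. (SUP x. ennreal (cmod (g (x + \<tau>) - g x))) < ennreal e}" if "e > 0" for e
  proof -
    obtain F d where F: "finite F" "d > 0"
      "\<And>\<tau> t. (\<forall>l\<in>F. cmod (cis (2 * pi * (\<tau> \<bullet> l)) - 1) < d) \<Longrightarrow> cmod (g (t + \<tau>) - g t) \<le> e / 2"
      using est[of "e / 2"] \<open>e > 0\<close> by auto
    show ?thesis
    proof (rule relatively_dense_mono[OF relatively_dense_simultaneous[OF F(1,2)]], rule subsetI)
      fix \<tau> assume "\<tau> \<in> {\<tau>. \<forall>l\<in>F. cmod (cis (2 * pi * (\<tau> \<bullet> l)) - 1) < d}"
      \<comment> \<open>The bound e/2 in place of e keeps the supremum strictly below e.\<close>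
      then have "cmod (g (x + \<tau>) - g x) \<le> e / 2" for x by (intro F(3)) blast
      then have "(SUP x. ennreal (cmod (g (x + \<tau>) - g x))) \<le> ennreal (e / 2)"
        by (intro SUP_least ennreal_leI)
      also have "\<dots> < ennreal e" using \<open>e > 0\<close> by (intro ennreal_lessI) auto
      finally show "\<tau> \<in> {\<tau>. (SUP x. ennreal (cmod (g (x + \<tau>) - g x))) < ennreal e}" by simp
    qed
  qed
  ultimately show ?thesis unfolding almost_periodic_def g_def by blast
qed

text \<open>The substitution u = t - x moves the whole dependence on t into one character, so t
  drops out of the coefficients of the series.\<close>

lemma fourier_reflect:
  assumes "\<psi> \<in> schwartz"
  shows "fourier (\<lambda>x. \<psi> (t - x)) (- l) = fourier \<psi> l * cis (2 * pi * (t \<bullet> l))"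
proof -
  have [measurable]: "\<psi> \<in> borel_measurable borel" using assms by (intro rapid_measurable schwartz_rapid)
  have "fourier (\<lambda>x. \<psi> (t - x)) (- l) = (\<integral>x. \<psi> (t - x) * cis (2 * pi * (x \<bullet> l)) \<partial>lborel)"
    by (simp add: fourier_cis)
  also have "\<dots> = (\<integral>u. \<psi> (t - (t + (-1) *\<^sub>R u)) * cis (2 * pi * ((t + (-1) *\<^sub>R u) \<bullet> l)) \<partial>lborel)"
    by (subst lborel_integral_affine[of _ "-1" t]) auto
  also have "\<dots> = (\<integral>u. \<psi> u * cis (- 2 * pi * (u \<bullet> l)) * cis (2 * pi * (t \<bullet> l)) \<partial>lborel)"
    by (rule Bochner_Integration.integral_cong) (auto simp: mult.assoc cis_mult inner_diff_left algebra_simps)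
  also have "\<dots> = fourier \<psi> l * cis (2 * pi * (t \<bullet> l))"
    unfolding fourier_cis by (rule integral_mult_left_zero)
  finally show ?thesis .
qed

theorem theorem2:
  fixes f :: "('a::euclidean_space \<Rightarrow> complex) \<Rightarrow> complex"
    and \<mu> :: "'a set \<Rightarrow> complex"
    and T :: real
  assumes "tempered_distribution f"
    and "distribution_is_measure (fourier_dist f) \<mu>"
    and "pure_point \<mu>"
    and "(\<lambda>r. enn2real (variation \<mu> (ball 0 r))) \<in> O(\<lambda>r. r powr T)"
  shows "s_almost_periodic f"
proof -
  obtain \<Lambda> a where \<Lambda>: "countable \<Lambda>"
    and \<mu>: "\<And>E. E \<in> bounded_borel \<Longrightarrow> ((\<lambda>l. a l * indicator E l) has_sum \<mu> E) \<Lambda>"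
    using assms(3) unfolding pure_point_def by blast
  have fin: "variation \<mu> E < \<infinity>" if "E \<in> bounded_borel" for E
    using assms(2) that by (simp add: distribution_is_measure_def complex_radon_measure_def)
  obtain N where N: "integrable (count_space \<Lambda>) (\<lambda>l. cmod (a l) / (1 + norm l) ^ N)"
    using integrable_pure_point_weight[OF \<mu> fin assms(4)] by blast
  \<comment> \<open>Any factor decaying like (1 + |l|)^(-N) is summable against the atoms. This
    serves the truncated terms, their limit and the final coefficients alike.\<close>
  have int: "integrable (count_space \<Lambda>) (\<lambda>l. a l * q l)"
    if "\<And>l. (1 + norm l) ^ N * cmod (q l) \<le> B" for q B
  proof (rule Bochner_Integration.integrable_bound)
    show "integrable (count_space \<Lambda>) (\<lambda>l. B * (cmod (a l) / (1 + norm l) ^ N))"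
      by (rule integrable_mult_right[OF N])
    have "cmod (a l * q l) \<le> norm (B * (cmod (a l) / (1 + norm l) ^ N))" for l
    proof -
      have "cmod (q l) \<le> B / (1 + norm l) ^ N"
        using that[of l] by (simp add: field_simps add_pos_nonneg)
      from mult_left_mono[OF this norm_ge_zero[of "a l"]]
      have "cmod (a l * q l) \<le> B * (cmod (a l) / (1 + norm l) ^ N)"
        by (simp add: norm_mult mult.commute)
      also have "\<dots> \<le> norm \<dots>" by (simp only: real_norm_def abs_ge_self)
      finally show ?thesis .
    qed
    then show "AE l in count_space \<Lambda>. cmod (a l * q l) \<le> norm (B * (cmod (a l) / (1 + norm l) ^ N))" by simp
  qed simp
  obtain h :: "'a \<Rightarrow> complex" where h: "smooth h" "compact (closure {x. h x \<noteq> 0})"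
    and c0: "(\<integral>x. fourier h x \<partial>lborel) \<noteq> 0"
    by (rule ex_cutoff)
  define c where "c = (\<integral>x. fourier h x \<partial>lborel)"
  have hS: "h \<in> schwartz" by (rule compact_support_schwartz[OF h])
  \<comment> \<open>A bound for the cutoff itself, which makes the dominating function independent
    of n.\<close>
  obtain Ch where Ch: "Ch \<ge> 0" "\<And>x. (1 + norm x) ^ 0 * norm (iter_partial [] h x) \<le> Ch"
    by (rule schwartz_decay[OF hS, of "[]" 0]) auto
  \<comment> \<open>The two sides are limits of one and the same sequence, computed with the
    distribution and with the measure respectively.\<close>
  have formula: "c * f \<omega> = h 0 * (\<integral>l. a l * fourier \<omega> (- l) \<partial>count_space \<Lambda>)" if \<omega>: "\<omega> \<in> schwartz" for \<omega>
  proof (rule LIMSEQ_unique)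
    let ?s = "\<lambda>n. 1 / real (Suc n)"
    let ?\<phi> = "\<lambda>n y. h (?s n *\<^sub>R y) * fourier \<omega> (- y)"
    show "(\<lambda>n. f (convolve \<omega> (fourier h) (?s n))) \<longlonglongrightarrow> c * f \<omega>"
      unfolding c_def by (rule tempered_distribution_convolve[OF assms(1) \<omega> fourier_rapid[OF hS]])
    obtain B where B: "\<And>y. (1 + norm y) ^ N * norm (fourier \<omega> y) \<le> B"
      using fourier_rapid[OF \<omega>] unfolding rapid_def by blast
    have B': "(1 + norm l) ^ N * norm (fourier \<omega> (- l)) \<le> B" for l using B[of "- l"] by simp
    have sF: "smooth (\<lambda>y. fourier \<omega> (- y))"
      using smooth_affine[OF smooth_fourier[OF schwartz_rapid[OF \<omega>]], of "-1" 0] by simp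
    have \<phi>b: "cmod (?\<phi> n y) \<le> Ch * cmod (fourier \<omega> (- y))" for n y
      using Ch(2)[of "?s n *\<^sub>R y"] by (auto simp: norm_mult intro!: mult_right_mono)
    have f\<phi>: "f (convolve \<omega> (fourier h) (?s n)) = (\<integral>l. a l * ?\<phi> n l \<partial>count_space \<Lambda>)" for n
    proof -
      have sm: "smooth (?\<phi> n)"
        using smooth_mult[OF smooth_affine[OF h(1), of "?s n" 0] sF] by simp
      have supp: "compact (closure {y. ?\<phi> n y \<noteq> 0})"
      proof -
        have "bounded {x. h x \<noteq> 0}" using h(2) bounded_closure_image compact_imp_bounded closure_subset bounded_subset by metis
        then have "bounded ((\<lambda>x. real (Suc n) *\<^sub>R x) ` {x. h x \<noteq> 0})" by (rule bounded_scaling)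
        moreover have "{y. ?\<phi> n y \<noteq> 0} \<subseteq> (\<lambda>x. real (Suc n) *\<^sub>R x) ` {x. h x \<noteq> 0}"
        proof
          fix y assume "y \<in> {y. ?\<phi> n y \<noteq> 0}"
          then have "h (?s n *\<^sub>R y) \<noteq> 0" by auto
          moreover have "y = real (Suc n) *\<^sub>R (?s n *\<^sub>R y)" by (simp del: of_nat_Suc)
          ultimately show "y \<in> (\<lambda>x. real (Suc n) *\<^sub>R x) ` {x. h x \<noteq> 0}" by blast
        qed
        ultimately have "bounded {y. ?\<phi> n y \<noteq> 0}" by (rule bounded_subset)
        then show ?thesis by (simp only: compact_closure)
      qed
      \<comment> \<open>Here distribution and measure meet: the convolution is the transform of a
        compactly supported smooth function, on which the transform of \<open>f\<close> is
        integration against \<open>\<mu>\<close>.\<close>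
      have "f (convolve \<omega> (fourier h) (?s n)) = fourier_dist f (?\<phi> n)"
        unfolding fourier_dist_def by (subst fourier_cutoff[OF hS \<omega>]) auto
      also have "\<dots> = cmeasure_integral \<mu> (?\<phi> n)"
        using assms(2) sm supp unfolding distribution_is_measure_def by blast
      also have "\<dots> = (\<integral>l. a l * ?\<phi> n l \<partial>count_space \<Lambda>)"
      proof (rule cmeasure_integral_pure_point[OF \<Lambda> \<mu>])
        show "?\<phi> n \<in> borel_measurable borel"
          by (intro borel_measurable_continuous_onI smooth_continuous_on sm)
        show "integrable (count_space \<Lambda>) (\<lambda>l. a l * ?\<phi> n l)"
        proof (rule int)
          fix l
          have "(1 + norm l) ^ N * cmod (?\<phi> n l) \<le> (1 + norm l) ^ N * (Ch * cmod (fourier \<omega> (- l)))"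
            by (intro mult_left_mono \<phi>b) auto
          also have "\<dots> = Ch * ((1 + norm l) ^ N * cmod (fourier \<omega> (- l)))" by simp
          also have "\<dots> \<le> Ch * B" by (intro mult_left_mono B' Ch)
          finally show "(1 + norm l) ^ N * cmod (?\<phi> n l) \<le> Ch * B" .
        qed
      qed
      finally show ?thesis .
    qed
    \<comment> \<open>For each fixed atom the cutoff factor tends to h 0, and the terms are
      dominated by \<open>Ch\<close> times the terms of an absolutely convergent series.\<close>
    have "(\<lambda>n. \<integral>l. a l * ?\<phi> n l \<partial>count_space \<Lambda>) \<longlonglongrightarrow> (\<integral>l. h 0 * (a l * fourier \<omega> (- l)) \<partial>count_space \<Lambda>)"
    proof (rule integral_dominated_convergence)
      show "integrable (count_space \<Lambda>) (\<lambda>l. Ch * cmod (a l * fourier \<omega> (- l)))"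
        by (intro integrable_mult_right integrable_norm int[OF B'])
      have "(\<lambda>n. a l * ?\<phi> n l) \<longlonglongrightarrow> a l * (h (0 *\<^sub>R l) * fourier \<omega> (- l))" for l
      proof (intro tendsto_intros)
        have "(\<lambda>n. ?s n *\<^sub>R l) \<longlonglongrightarrow> 0 *\<^sub>R l"
          by (intro tendsto_intros LIMSEQ_inverse_real_of_nat[unfolded inverse_eq_divide])
        then show "(\<lambda>n. h (?s n *\<^sub>R l)) \<longlonglongrightarrow> h (0 *\<^sub>R l)"
          by (rule continuous_on_tendsto_compose[OF smooth_continuous_on[OF h(1), of UNIV]]) auto
      qed
      then show "AE l in count_space \<Lambda>. (\<lambda>n. a l * ?\<phi> n l) \<longlonglongrightarrow> h 0 * (a l * fourier \<omega> (- l))"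
        by (simp add: mult_ac)
      show "AE l in count_space \<Lambda>. cmod (a l * ?\<phi> n l) \<le> Ch * cmod (a l * fourier \<omega> (- l))" for n
      proof (rule AE_I2)
        fix l
        from mult_left_mono[OF \<phi>b[of n l] norm_ge_zero[of "a l"]]
        show "cmod (a l * ?\<phi> n l) \<le> Ch * cmod (a l * fourier \<omega> (- l))"
          by (simp only: norm_mult mult_ac)
      qed
    qed auto
    then show "(\<lambda>n. f (convolve \<omega> (fourier h) (?s n))) \<longlonglongrightarrow> h 0 * (\<integral>l. a l * fourier \<omega> (- l) \<partial>count_space \<Lambda>)"
      unfolding f\<phi> by (simp only: integral_mult_right_zero)
  qed
  show ?thesis
    unfolding s_almost_periodic_def
  proof
    fix \<psi> :: "'a \<Rightarrow> complex" assume \<psi>: "\<psi> \<in> schwartz"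
    \<comment> \<open>The Fourier coefficients of the function of t, obtained from the formula by
      dividing by the nonzero constant c.\<close>
    define e where "e l = (h 0 / c) * (a l * fourier \<psi> l)" for l
    have "f (\<lambda>x. \<psi> (t - x)) = (\<integral>l. e l * cis (2 * pi * (t \<bullet> l)) \<partial>count_space \<Lambda>)" for t
    proof -
      have "f (\<lambda>x. \<psi> (t - x)) = (h 0 / c) * (\<integral>l. a l * fourier (\<lambda>x. \<psi> (t - x)) (- l) \<partial>count_space \<Lambda>)"
        using formula[OF schwartz_reflect[OF \<psi>, of t]] c0 by (simp add: c_def field_simps)
      also have "\<dots> = (\<integral>l. (h 0 / c) * (a l * fourier (\<lambda>x. \<psi> (t - x)) (- l)) \<partial>count_space \<Lambda>)"
        by (rule integral_mult_right_zero[symmetric])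
      also have "\<dots> = (\<integral>l. e l * cis (2 * pi * (t \<bullet> l)) \<partial>count_space \<Lambda>)"
        unfolding fourier_reflect[OF \<psi>] e_def by (simp only: mult.assoc)
      finally show ?thesis .
    qed
    moreover have "integrable (count_space \<Lambda>) e"
    proof -
      obtain B where "\<And>y. (1 + norm y) ^ N * norm (fourier \<psi> y) \<le> B"
        using fourier_rapid[OF \<psi>] unfolding rapid_def by blast
      then show ?thesis unfolding e_def by (intro integrable_mult_right int)
    qed
    ultimately show "almost_periodic (\<lambda>t. f (\<lambda>x. \<psi> (t - x)))"
      using almost_periodic_fourier_series[of \<Lambda> e] by simp
  qed
qed

end
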